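(* Let $\mathbb{H}=\{(z_1,z_2)\in\mathbb{C}^2:\ |z_2|<|z_1|<1\}$ be the Hartogs triangle, let $\delta(z)=|z_1|$ and $\mu(z)=\exp\left(-\frac{1}{|z_1|}\right)$ for $z=(z_1,z_2)\in\mathbb{H}$, and let $B^{\mu}_{\mathbb{H}}(z,w)$ be the weighted Bergman kernel of $\mathbb{H}$ with weight $\mu$. For $\gamma>1$ let $V_{\gamma}=\{(z_1,z_2)\in\mathbb{C}^2:\ \gamma|z_2|<|z_1|\}$. Then for every $\tau>0$ and every $\gamma>1$, the function $$z\mapsto\delta(z)^{\tau}\,B^{\mu}_{\mathbb{H}}(z,z)$$ is unbounded as $z$ approaches the origin inside $V_{\gamma}$; that is, for every $r>0$ it is unbounded on $\{z\in\mathbb{H}\cap V_{\gamma}:\ |z|<r\}$.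
   Context: $dV$ denotes Lebesgue measure on $\mathbb{C}^2$. $L^2(\mathbb{H},\mu)$ is the Hilbert space of measurable functions on $\mathbb{H}$ that are square integrable with respect to $\mu\,dV$, and $L^2_a(\mathbb{H},\mu)$ is its closed subspace of holomorphic functions. The weighted Bergman kernel $B^{\mu}_{\mathbb{H}}(z,w)$ is the integral kernel of the orthogonal projection $\mathbf{B}^{\mu}_{\mathbb{H}}$ from $L^2(\mathbb{H},\mu)$ onto $L^2_a(\mathbb{H},\mu)$, i.e. $\mathbf{B}^{\mu}_{\mathbb{H}}f(z)=\int_{\mathbb{H}}B^{\mu}_{\mathbb{H}}(z,w)f(w)\mu(w)\,dV(w)$ for $f\in L^2(\mathbb{H},\mu)$; equivalently, it is the reproducing kernel of $L^2_a(\mathbb{H},\mu)$. *)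

theory Defs
  imports "HOL-Analysis.Analysis"
begin

text \<open>
  Holomorphy in two complex variables is complex (Frechet) differentiability: the real derivative
  is \<open>\<complex>\<close>-linear, i.e. of the form \<open>h \<mapsto> a h\<^sub>1 + b h\<^sub>2\<close>.  Intended for open \<open>\<Omega>\<close>.
\<close>

definition holomorphic2_on :: "(complex \<times> complex \<Rightarrow> complex) \<Rightarrow> (complex \<times> complex) set \<Rightarrow> bool"
  where "holomorphic2_on f \<Omega> \<longleftrightarrow>
    (\<forall>z\<in>\<Omega>. \<exists>a b. (f has_derivative (\<lambda>h. a * fst h + b * snd h)) (at z within \<Omega>))"

definition weighted_measure ::
    "(complex \<times> complex) set \<Rightarrow> (complex \<times> complex \<Rightarrow> real) \<Rightarrow> (complex \<times> complex) measure"
  where "weighted_measure \<Omega> \<mu> = density (lebesgue_on \<Omega>) (\<lambda>z. ennreal (\<mu> z))"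

text \<open>
  Elements of the two spaces below are functions, not classes of functions equal almost everywhere,
  and their values off \<open>\<Omega>\<close> are irrelevant.
\<close>

definition weighted_L2 ::
    "(complex \<times> complex) set \<Rightarrow> (complex \<times> complex \<Rightarrow> real) \<Rightarrow> (complex \<times> complex \<Rightarrow> complex) set"
  where "weighted_L2 \<Omega> \<mu> =
    {f \<in> borel_measurable (weighted_measure \<Omega> \<mu>).
       integrable (weighted_measure \<Omega> \<mu>) (\<lambda>z. (cmod (f z))\<^sup>2)}"

definition weighted_L2a ::
    "(complex \<times> complex) set \<Rightarrow> (complex \<times> complex \<Rightarrow> real) \<Rightarrow> (complex \<times> complex \<Rightarrow> complex) set"
  where "weighted_L2a \<Omega> \<mu> = {f \<in> weighted_L2 \<Omega> \<mu>. holomorphic2_on f \<Omega>}"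

definition is_bergman_projection ::
    "(complex \<times> complex) set \<Rightarrow> (complex \<times> complex \<Rightarrow> real) \<Rightarrow>
     (complex \<times> complex \<Rightarrow> complex) \<Rightarrow> (complex \<times> complex \<Rightarrow> complex) \<Rightarrow> bool"
  where "is_bergman_projection \<Omega> \<mu> f g \<longleftrightarrow>
    g \<in> weighted_L2a \<Omega> \<mu> \<and>
    (\<forall>h\<in>weighted_L2a \<Omega> \<mu>. (\<integral>z. (f z - g z) * cnj (h z) \<partial>weighted_measure \<Omega> \<mu>) = 0)"

text \<open>
  The second conjunct says that \<open>K\<close> is the integral kernel of the orthogonal projection.  It
  determines \<open>K z\<close> only up to null sets, whereas values on the diagonal are needed; the first
  conjunct selects the (unique) representative which is conjugate holomorphic in the second argument.
\<close>

definition is_bergman_kernel ::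
    "(complex \<times> complex) set \<Rightarrow> (complex \<times> complex \<Rightarrow> real) \<Rightarrow>
     (complex \<times> complex \<Rightarrow> complex \<times> complex \<Rightarrow> complex) \<Rightarrow> bool"
  where "is_bergman_kernel \<Omega> \<mu> K \<longleftrightarrow>
    (\<forall>z\<in>\<Omega>. (\<lambda>w. cnj (K z w)) \<in> weighted_L2a \<Omega> \<mu>) \<and>
    (\<forall>f\<in>weighted_L2 \<Omega> \<mu>.
       is_bergman_projection \<Omega> \<mu> f (\<lambda>z. \<integral>w. K z w * f w \<partial>weighted_measure \<Omega> \<mu>))"

text \<open>
  For open \<open>\<Omega>\<close> and continuous \<open>\<mu> > 0\<close> such a \<open>K\<close> exists and is unique on \<open>\<Omega> \<times> \<Omega>\<close>; the choice
  only affects arguments outside \<open>\<Omega>\<close>.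
\<close>

definition bergman_kernel ::
    "(complex \<times> complex) set \<Rightarrow> (complex \<times> complex \<Rightarrow> real) \<Rightarrow>
     complex \<times> complex \<Rightarrow> complex \<times> complex \<Rightarrow> complex"
  where "bergman_kernel \<Omega> \<mu> = (SOME K. is_bergman_kernel \<Omega> \<mu> K)"

definition hartogs_triangle :: "(complex \<times> complex) set"
  where "hartogs_triangle = {z. cmod (snd z) < cmod (fst z) \<and> cmod (fst z) < 1}"

definition hartogs_delta :: "complex \<times> complex \<Rightarrow> real"
  where "hartogs_delta z = cmod (fst z)"

definition hartogs_weight :: "complex \<times> complex \<Rightarrow> real"
  where "hartogs_weight z = exp (- (1 / cmod (fst z)))"

definition hartogs_cone :: "real \<Rightarrow> (complex \<times> complex) set"
  where "hartogs_cone \<gamma> = {z. \<gamma> * cmod (snd z) < cmod (fst z)}"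

end

theory Submission
  imports Defs "HOL-Complex_Analysis.Cauchy_Integral_Formula"
begin

text \<open>
  The weight \<open>exp (- 1 / \<bar>z\<^sub>1\<bar>)\<close> decays at \<open>z\<^sub>1 = 0\<close> faster than every power of \<open>\<bar>z\<^sub>1\<bar>\<close>, so every
  negative power \<open>z\<^sub>1\<^sup>-\<^sup>N\<close> is square integrable and belongs to the weighted Bergman space
  (\<open>negative_power_in_hartogs_L2a\<close>).  For every \<open>f\<close> in this space, the reproducing property and the
  Cauchy-Schwarz inequality give \<open>\<bar>f z\<bar>\<^sup>2 \<le> K z z * \<parallel>f\<parallel>\<^sup>2\<close> (\<open>bergman_kernel_diagonal_bound\<close>).  With
  \<open>f = z\<^sub>1\<^sup>-\<^sup>N\<close> and \<open>z = (t, 0)\<close>, a point of every cone, \<open>t\<^sup>\<tau> * K z z\<close> is at least a constant multiple of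
  \<open>t\<^sup>\<tau>\<^sup>-\<^sup>2\<^sup>N\<close>, which is unbounded as \<open>t \<rightarrow> 0\<close> once \<open>2 N > \<tau>\<close>.

  The kernel is a choice among the functions with the defining property, so these estimates say something
  only if such a function exists.  Existence is shown for every open \<open>\<Omega>\<close> and every positive
  continuous weight (\<open>bergman_kernel_exists\<close>).  Evaluation at a point is a bounded functional on the
  Bergman space, so the Riesz representation theorem provides \<open>k\<^sub>z\<close> with \<open>h z = \<langle>h, k\<^sub>z\<rangle>\<close>; it also
  provides the orthogonal projection \<open>P\<close>, and \<open>P f z = \<langle>P f, k\<^sub>z\<rangle> = \<langle>f, k\<^sub>z\<rangle>\<close> exhibits
  \<open>K z w = cnj (k\<^sub>z w)\<close> as its integral kernel.

  Both uses of Riesz rest on one estimate: values and first derivatives of \<open>f\<close> near a point are bounded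
  by the weighted \<open>L\<^sup>2\<close> norm of \<open>f\<close> (\<open>local_C1_bound\<close>).  It makes evaluation bounded, and it turns
  \<open>L\<^sup>2\<close> Cauchy sequences into locally \<open>C\<^sup>1\<close> convergent ones, whence completeness.  The estimate comes
  from the sub-mean value property of \<open>\<bar>f\<bar>\<^sup>2\<close> on balls of \<open>\<complex>\<^sup>2\<close> (\<open>holomorphic2_submean\<close>): on each circle
  \<open>z + e\<^sup>i\<^sup>\<theta> w\<close> it is Cauchy's formula in one variable, and integrating over \<open>w\<close> yields the ball, because
  the rotations \<open>w \<mapsto> e\<^sup>i\<^sup>\<theta> w\<close> preserve Lebesgue measure.
\<close>

section \<open>Rotation invariance of Lebesgue measure on \<open>\<complex>\<^sup>2\<close>\<close>

lemma lborel_complex_eq_distr: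
  "(lborel :: complex measure) = distr (lborel \<Otimes>\<^sub>M lborel) borel (\<lambda>(x, y). Complex x y)"
proof (rule lborel_eqI)
  have Complex_eq: "(\<lambda>(x, y). Complex x y) = (\<lambda>p. of_real (fst p) + \<i> * of_real (snd p))"
    by (auto simp: fun_eq_iff complex_eq_iff)
  have meas: "(\<lambda>(x, y). Complex x y) \<in> borel_measurable (lborel \<Otimes>\<^sub>M lborel)"
    unfolding Complex_eq lborel_prod
    by (simp, intro borel_measurable_continuous_onI continuous_intros)
  fix l u :: complex
  assume lu: "\<And>b. b \<in> Basis \<Longrightarrow> l \<bullet> b \<le> u \<bullet> b"
  then have le: "Re l \<le> Re u" "Im l \<le> Im u"
    using lu[of 1] lu[of "\<i>"] by (auto simp: Basis_complex_def)
  have pre: "(\<lambda>(x, y). Complex x y) -` box l u \<inter> space (lborel \<Otimes>\<^sub>M lborel)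
      = {Re l <..< Re u} \<times> {Im l <..< Im u}"
    by (auto simp: box_def Basis_complex_def space_pair_measure)
  have "emeasure (distr (lborel \<Otimes>\<^sub>M lborel) borel (\<lambda>(x, y). Complex x y)) (box l u)
      = emeasure (lborel \<Otimes>\<^sub>M lborel) ({Re l <..< Re u} \<times> {Im l <..< Im u})"
    by (subst emeasure_distr[OF meas]) (auto simp: pre)
  also have "\<dots> = emeasure lborel {Re l <..< Re u} * emeasure lborel {Im l <..< Im u}"
    by (intro lborel.emeasure_pair_measure_Times) auto
  also have "\<dots> = ennreal (\<Prod>b\<in>Basis. (u - l) \<bullet> b)"
    using le by (simp add: Basis_complex_def ennreal_mult)
  finally show "emeasure (distr (lborel \<Otimes>\<^sub>M lborel) borel (\<lambda>(x, y). Complex x y)) (box l u)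
      = ennreal (\<Prod>b\<in>Basis. (u - l) \<bullet> b)" .
qed simp

lemma nn_integral_lborel_complex:
  fixes g :: "complex \<Rightarrow> ennreal"
  assumes [measurable]: "g \<in> borel_measurable borel"
  shows "(\<integral>\<^sup>+z. g z \<partial>lborel) = (\<integral>\<^sup>+y. \<integral>\<^sup>+x. g (Complex x y) \<partial>lborel \<partial>lborel)"
    and "(\<integral>\<^sup>+z. g z \<partial>lborel) = (\<integral>\<^sup>+x. \<integral>\<^sup>+y. g (Complex x y) \<partial>lborel \<partial>lborel)"
proof -
  have Complex_eq: "(\<lambda>(x, y). Complex x y) = (\<lambda>p. of_real (fst p) + \<i> * of_real (snd p))"
    by (auto simp: fun_eq_iff complex_eq_iff)
  have meas[measurable]: "(\<lambda>(x, y). Complex x y) \<in> borel_measurable (lborel \<Otimes>\<^sub>M lborel)"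
    unfolding Complex_eq lborel_prod
    by (simp, intro borel_measurable_continuous_onI continuous_intros)
  have eq: "(\<integral>\<^sup>+z. g z \<partial>lborel) = (\<integral>\<^sup>+p. g (case p of (x, y) \<Rightarrow> Complex x y) \<partial>(lborel \<Otimes>\<^sub>M lborel))"
    by (subst lborel_complex_eq_distr, subst nn_integral_distr) auto
  show "(\<integral>\<^sup>+z. g z \<partial>lborel) = (\<integral>\<^sup>+y. \<integral>\<^sup>+x. g (Complex x y) \<partial>lborel \<partial>lborel)"
    unfolding eq by (subst lborel_pair.nn_integral_snd[symmetric]) auto
  show "(\<integral>\<^sup>+z. g z \<partial>lborel) = (\<integral>\<^sup>+x. \<integral>\<^sup>+y. g (Complex x y) \<partial>lborel \<partial>lborel)"
    unfolding eq by (subst lborel.nn_integral_fst[symmetric]) auto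
qed

lemma nn_integral_lborel_translate:
  fixes g :: "'a::euclidean_space \<Rightarrow> ennreal"
  assumes [measurable]: "g \<in> borel_measurable borel"
  shows "(\<integral>\<^sup>+x. g (x + c) \<partial>lborel) = (\<integral>\<^sup>+x. g x \<partial>lborel)"
  by (subst (2) lborel_distr_plus[of c, symmetric], subst nn_integral_distr) (auto simp: add.commute)

text \<open>
  Integrating first along the direction of the shear, each inner integral is merely translated.
\<close>

lemma nn_integral_shear:
  fixes g :: "complex \<Rightarrow> ennreal"
  assumes [measurable]: "g \<in> borel_measurable borel"
  shows nn_integral_horizontal_shear:
      "(\<integral>\<^sup>+z. g (z + of_real (t * Im z)) \<partial>lborel) = (\<integral>\<^sup>+z. g z \<partial>lborel)"
    and nn_integral_vertical_shear:
      "(\<integral>\<^sup>+z. g (z + \<i> * of_real (t * Re z)) \<partial>lborel) = (\<integral>\<^sup>+z. g z \<partial>lborel)"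
proof -
  have Complex_eq: "Complex = (\<lambda>x y. of_real x + \<i> * of_real y)"
    by (auto simp: fun_eq_iff complex_eq_iff)
  have "(\<integral>\<^sup>+z. g (z + of_real (t * Im z)) \<partial>lborel)
      = (\<integral>\<^sup>+y. \<integral>\<^sup>+x. g (Complex (x + t * y) y) \<partial>lborel \<partial>lborel)"
    by (subst nn_integral_lborel_complex(1)) (auto simp: Complex_eq algebra_simps)
  also have "\<dots> = (\<integral>\<^sup>+y. \<integral>\<^sup>+x. g (Complex x y) \<partial>lborel \<partial>lborel)"
    by (subst nn_integral_lborel_translate) (auto simp: Complex_eq)
  finally show "(\<integral>\<^sup>+z. g (z + of_real (t * Im z)) \<partial>lborel) = (\<integral>\<^sup>+z. g z \<partial>lborel)"
    by (simp add: nn_integral_lborel_complex(1))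
  have "(\<integral>\<^sup>+z. g (z + \<i> * of_real (t * Re z)) \<partial>lborel)
      = (\<integral>\<^sup>+x. \<integral>\<^sup>+y. g (Complex x (y + t * x)) \<partial>lborel \<partial>lborel)"
    by (subst nn_integral_lborel_complex(2)) (auto simp: Complex_eq algebra_simps)
  also have "\<dots> = (\<integral>\<^sup>+x. \<integral>\<^sup>+y. g (Complex x y) \<partial>lborel \<partial>lborel)"
    by (subst nn_integral_lborel_translate) (auto simp: Complex_eq)
  finally show "(\<integral>\<^sup>+z. g (z + \<i> * of_real (t * Re z)) \<partial>lborel) = (\<integral>\<^sup>+z. g z \<partial>lborel)"
    by (simp add: nn_integral_lborel_complex(2))
qed

text \<open>
  A rotation by \<open>2 a\<close> is a composition of three shears: a horizontal one with slope \<open>- tan a\<close>, a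
  vertical one with slope \<open>sin (2 * a)\<close>, and the horizontal one again.  For a half turn the slope
  \<open>tan a\<close> has a pole.
\<close>

lemma nn_integral_rotate_not_half_turn:
  fixes g :: "complex \<Rightarrow> ennreal"
  assumes [measurable]: "g \<in> borel_measurable borel" and a: "cos a \<noteq> 0"
  shows "(\<integral>\<^sup>+z. g (cis (2 * a) * z) \<partial>lborel) = (\<integral>\<^sup>+z. g z \<partial>lborel)"
proof -
  define H where "H = (\<lambda>z. z + of_real (- tan a * Im z))"
  define V where "V = (\<lambda>z. z + \<i> * of_real (sin (2 * a) * Re z))"
  have [measurable]: "H \<in> borel_measurable borel" "V \<in> borel_measurable borel"
    unfolding H_def V_def by (auto intro!: borel_measurable_continuous_onI continuous_intros)
  have c: "cos (2 * a) = 2 * (cos a)\<^sup>2 - 1" "sin (2 * a) = 2 * sin a * cos a"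
    by (simp_all add: cos_double_cos sin_double)
  have t: "tan a * cos a = sin a"
    using a by (simp add: tan_def)
  have s: "sin a * sin a = 1 - cos a * cos a"
    using sin_cos_squared_add[of a] by (simp add: power2_eq_square)
  have ts: "tan a * sin (2 * a) = 1 - cos (2 * a)"
  proof -
    have "tan a * sin (2 * a) = 2 * sin a * (tan a * cos a)"
      unfolding c by simp
    also have "\<dots> = 1 - cos (2 * a)"
      unfolding t c using s by (simp add: power2_eq_square)
    finally show ?thesis .
  qed
  have tc: "tan a * (1 + cos (2 * a)) = sin (2 * a)"
    unfolding c using t by (simp add: power2_eq_square algebra_simps)
  have "cis (2 * a) * z = H (V (H z))" for z
  proof (rule complex_eqI)
    have "Re (H (V (H z))) = (1 - tan a * sin (2 * a)) * (Re z - tan a * Im z) - tan a * Im z"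
      by (simp add: H_def V_def algebra_simps)
    also have "\<dots> = cos (2 * a) * Re z - (tan a * (1 + cos (2 * a))) * Im z"
      unfolding ts by (simp add: algebra_simps)
    finally show "Re (cis (2 * a) * z) = Re (H (V (H z)))"
      unfolding tc by simp
    have "Im (H (V (H z))) = sin (2 * a) * Re z + (1 - tan a * sin (2 * a)) * Im z"
      by (simp add: H_def V_def algebra_simps)
    then show "Im (cis (2 * a) * z) = Im (H (V (H z)))"
      unfolding ts by simp
  qed
  then have "(\<integral>\<^sup>+z. g (cis (2 * a) * z) \<partial>lborel) = (\<integral>\<^sup>+z. g (H (V (H z))) \<partial>lborel)"
    by simp
  also have "\<dots> = (\<integral>\<^sup>+z. g (H (V z)) \<partial>lborel)"
    using nn_integral_horizontal_shear[of "\<lambda>z. g (H (V z))" "- tan a"] by (simp add: H_def)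
  also have "\<dots> = (\<integral>\<^sup>+z. g (H z) \<partial>lborel)"
    using nn_integral_vertical_shear[of "\<lambda>z. g (H z)" "sin (2 * a)"] by (simp add: V_def)
  also have "\<dots> = (\<integral>\<^sup>+z. g z \<partial>lborel)"
    using nn_integral_horizontal_shear[of g "- tan a"] by (simp add: H_def)
  finally show ?thesis .
qed

lemma nn_integral_rotate:
  fixes g :: "complex \<Rightarrow> ennreal"
  assumes [measurable]: "g \<in> borel_measurable borel" and u: "cmod u = 1"
  shows "(\<integral>\<^sup>+z. g (u * z) \<partial>lborel) = (\<integral>\<^sup>+z. g z \<partial>lborel)"
proof -
  \<comment> \<open>A half turn has no shear decomposition, so every rotation is split into two equal ones.\<close>
  define b where "b = Arg u / 4"
  have "u = cis (2 * b) * cis (2 * b)"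
    using u cis_Arg[of u] by (cases "u = 0") (auto simp: b_def cis_mult sgn_div_norm)
  moreover have "cos b \<noteq> 0"
  proof -
    have "- (pi / 2) < b" "b < pi / 2"
      using Arg_bounded[of u] pi_gt_zero by (auto simp: b_def)
    then show ?thesis
      using cos_gt_zero_pi[of b] by auto
  qed
  ultimately have "(\<integral>\<^sup>+z. g (u * z) \<partial>lborel) = (\<integral>\<^sup>+z. g (cis (2 * b) * (cis (2 * b) * z)) \<partial>lborel)"
    by (simp add: mult.assoc)
  also have "\<dots> = (\<integral>\<^sup>+z. g z \<partial>lborel)"
    using nn_integral_rotate_not_half_turn[of "\<lambda>z. g (cis (2 * b) * z)" b]
      nn_integral_rotate_not_half_turn[of g b] \<open>cos b \<noteq> 0\<close> by simp
  finally show ?thesis .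
qed

lemma nn_integral_rotate2:
  fixes g :: "complex \<times> complex \<Rightarrow> ennreal"
  assumes [measurable]: "g \<in> borel_measurable borel" and u: "cmod u = 1"
  shows "(\<integral>\<^sup>+z. g (u * fst z, u * snd z) \<partial>lborel) = (\<integral>\<^sup>+z. g z \<partial>lborel)"
proof -
  have [measurable]: "g \<in> borel_measurable (borel \<Otimes>\<^sub>M borel)"
    by (simp add: borel_prod)
  have [measurable]: "g \<in> borel_measurable (lborel \<Otimes>\<^sub>M lborel)"
    by (simp add: lborel_prod)
  have "(\<integral>\<^sup>+z. g (u * fst z, u * snd z) \<partial>lborel)
      = (\<integral>\<^sup>+z. g (u * fst z, u * snd z) \<partial>(lborel \<Otimes>\<^sub>M lborel))"
    by (simp add: lborel_prod)
  also have "\<dots> = (\<integral>\<^sup>+x. \<integral>\<^sup>+y. g (u * x, u * y) \<partial>lborel \<partial>lborel)"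
    by (subst lborel.nn_integral_fst[symmetric]) auto
  also have "\<dots> = (\<integral>\<^sup>+x. \<integral>\<^sup>+y. g (u * x, y) \<partial>lborel \<partial>lborel)"
    using u by (intro nn_integral_cong nn_integral_rotate[of "\<lambda>y. g (_, y)"]) auto
  also have "\<dots> = (\<integral>\<^sup>+x. \<integral>\<^sup>+y. g (x, y) \<partial>lborel \<partial>lborel)"
    using u by (intro nn_integral_rotate[of "\<lambda>x. \<integral>\<^sup>+y. g (x, y) \<partial>lborel"]) auto
  also have "\<dots> = (\<integral>\<^sup>+z. g z \<partial>(lborel \<Otimes>\<^sub>M lborel))"
    by (subst lborel.nn_integral_fst[symmetric]) auto
  finally show ?thesis
    by (simp add: lborel_prod)
qed

section \<open>Holomorphic functions of two variables: mean values and Cauchy estimates\<close>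

text \<open>
  The contour integral in Cauchy's formula on the unit circle is the average of \<open>g\<close> over the circle.
  The integral is taken in the extended nonnegative reals, so that the order of integration over
  circles and balls can later be exchanged without an integrability check.
\<close>

lemma circle_submean:
  assumes hol: "g holomorphic_on cball 0 1"
  shows "ennreal (2 * pi * cmod (g 0)) \<le> (\<integral>\<^sup>+t. indicator {0..2 * pi} t * ennreal (cmod (g (cis t))) \<partial>lborel)"
proof -
  have "((\<lambda>u. g u / (u - 0)) has_contour_integral (2 * of_real pi * \<i> * g 0)) (circlepath 0 1)"
    using hol by (intro Cauchy_integral_circlepath_simple) auto
  then have "((\<lambda>t. g (cis t) / cis t * \<i> * cis t) has_integral (2 * of_real pi * \<i> * g 0)) {0..2 * pi}"
    by (simp add: circlepath_def has_contour_integral_part_circlepath_iff)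
  then have "((\<lambda>t. \<i> * g (cis t)) has_integral (\<i> * (2 * of_real pi * g 0))) {0..2 * pi}"
    by (simp add: mult_ac)
  from has_integral_mult_right[OF this, of "- \<i>"]
  have I: "((\<lambda>t. g (cis t)) has_integral (2 * of_real pi * g 0)) {0..2 * pi}"
    by (simp flip: mult.assoc)
  have cont: "continuous_on {0..2 * pi} (\<lambda>t. cmod (g (cis t)))"
    by (intro continuous_on_norm continuous_on_compose2[OF holomorphic_on_imp_continuous_on[OF hol]]
        continuous_intros) auto
  then have int: "((\<lambda>t. cmod (g (cis t))) has_integral (integral {0..2 * pi} (\<lambda>t. cmod (g (cis t))))) {0..2 * pi}"
    by (intro integrable_integral integrable_continuous_real)
  then have "(\<integral>\<^sup>+t. ennreal (cmod (g (cis t))) * indicator {0..2 * pi} t \<partial>lborel)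
      = ennreal (integral {0..2 * pi} (\<lambda>t. cmod (g (cis t))))"
    by (intro nn_integral_has_integral_lebesgue') auto
  moreover have "2 * pi * cmod (g 0) \<le> integral {0..2 * pi} (\<lambda>t. cmod (g (cis t)))"
  proof -
    have "norm (integral {0..2 * pi} (\<lambda>t. g (cis t))) \<le> integral {0..2 * pi} (\<lambda>t. cmod (g (cis t)))"
      by (rule Henstock_Kurzweil_Integration.integral_norm_bound_integral) (use I int in auto)
    then show ?thesis
      using integral_unique[OF I] by (simp add: norm_mult)
  qed
  ultimately show ?thesis
    by (simp add: ennreal_leI mult.commute)
qed

lemma holomorphic2_on_has_derivative_at:
  assumes "holomorphic2_on f \<Omega>" "open \<Omega>" "z \<in> \<Omega>"
  obtains a b where "(f has_derivative (\<lambda>h. a * fst h + b * snd h)) (at z)"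
  using assms at_within_open unfolding holomorphic2_on_def by metis

lemma holomorphic2_on_imp_continuous_on:
  assumes "holomorphic2_on f \<Omega>"
  shows "continuous_on \<Omega> f"
  using assms has_derivative_continuous
  unfolding holomorphic2_on_def continuous_on_eq_continuous_within by blast

lemma holomorphic2_on_add_cmul:
  assumes "holomorphic2_on f \<Omega>" "holomorphic2_on g \<Omega>"
  shows "holomorphic2_on (\<lambda>z. f z + c * g z) \<Omega>"
  unfolding holomorphic2_on_def
proof
  fix z assume "z \<in> \<Omega>"
  then obtain a b a' b' where
    "(f has_derivative (\<lambda>h. a * fst h + b * snd h)) (at z within \<Omega>)"
    "(g has_derivative (\<lambda>h. a' * fst h + b' * snd h)) (at z within \<Omega>)"
    using assms unfolding holomorphic2_on_def by meson
  then have "((\<lambda>z. f z + c * g z) has_derivative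
      (\<lambda>h. (a * fst h + b * snd h) + c * (a' * fst h + b' * snd h))) (at z within \<Omega>)"
    by (intro has_derivative_add has_derivative_mult_right)
  then have "((\<lambda>z. f z + c * g z) has_derivative
      (\<lambda>h. (a + c * a') * fst h + (b + c * b') * snd h)) (at z within \<Omega>)"
    by (simp add: algebra_simps)
  then show "\<exists>a b. ((\<lambda>z. f z + c * g z) has_derivative (\<lambda>h. a * fst h + b * snd h)) (at z within \<Omega>)"
    by blast
qed

text \<open>
  The restriction of a function of two variables to a complex line is how one-variable theory enters.
\<close>

lemma has_field_derivative_along_line:
  assumes "(f has_derivative (\<lambda>h. a * fst h + b * snd h)) (at (fst z + x * fst v, snd z + x * snd v))"
  shows "((\<lambda>x. f (fst z + x * fst v, snd z + x * snd v)) has_field_derivative (a * fst v + b * snd v)) (at x)"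
proof -
  have "((\<lambda>x. (fst z + x * fst v, snd z + x * snd v)) has_derivative (\<lambda>h. (h * fst v, h * snd v))) (at x)"
    by (auto intro!: derivative_eq_intros)
  from has_derivative_compose[OF this assms]
  have "((\<lambda>x. f (fst z + x * fst v, snd z + x * snd v)) has_derivative
      (\<lambda>h. a * (h * fst v) + b * (h * snd v))) (at x)"
    by simp
  moreover have "(\<lambda>h. a * (h * fst v) + b * (h * snd v)) = (*) (a * fst v + b * snd v)"
    by (simp add: fun_eq_iff algebra_simps)
  ultimately show ?thesis
    by (simp add: has_field_derivative_def)
qed

lemma norm_line_eq: "norm (x * fst v, x * snd v) = cmod x * norm (v :: complex \<times> complex)"
proof -
  have "(cmod x * cmod (fst v))\<^sup>2 + (cmod x * cmod (snd v))\<^sup>2 = (cmod x)\<^sup>2 * ((cmod (fst v))\<^sup>2 + (cmod (snd v))\<^sup>2)"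
    by (simp add: power_mult_distrib algebra_simps)
  then show ?thesis
    by (simp add: norm_prod_def norm_mult real_sqrt_mult)
qed

lemma line_in_ball:
  assumes "cmod x * norm v < r"
  shows "(fst z + x * fst v, snd z + x * snd v) \<in> ball z r"
proof -
  have "(fst z + x * fst v, snd z + x * snd v) = z + (x * fst v, x * snd v)"
    by (simp add: prod_eq_iff)
  moreover have "dist z (z + p) = norm p" for p
    by (simp add: dist_norm)
  ultimately show ?thesis
    using assms by (simp add: norm_line_eq del: add_Pair)
qed

lemma holomorphic_on_line:
  assumes f: "holomorphic2_on f \<Omega>" "open \<Omega>" and S: "ball z r \<subseteq> \<Omega>"
    "\<And>x. x \<in> A \<Longrightarrow> cmod x * norm v < r"
  shows "(\<lambda>x. f (fst z + x * fst v, snd z + x * snd v)) holomorphic_on A"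
proof -
  have "(\<lambda>x. f (fst z + x * fst v, snd z + x * snd v)) field_differentiable at x" if "x \<in> A" for x
  proof -
    have "(fst z + x * fst v, snd z + x * snd v) \<in> \<Omega>"
      using line_in_ball[OF S(2)[OF that]] S(1) by blast
    then obtain a b where "(f has_derivative (\<lambda>h. a * fst h + b * snd h)) (at (fst z + x * fst v, snd z + x * snd v))"
      using f holomorphic2_on_has_derivative_at by blast
    from has_field_derivative_along_line[OF this] show ?thesis
      using field_differentiable_def by blast
  qed
  then show ?thesis
    by (auto simp: holomorphic_on_def intro: field_differentiable_at_within)
qed

text \<open>
  For fixed \<open>w\<close> the function \<open>x \<mapsto> (f (z + x w))\<^sup>2\<close> is holomorphic near the closed unit disc, so
  \<open>\<bar>f z\<bar>\<^sup>2\<close> is at most the mean of \<open>\<bar>f\<bar>\<^sup>2\<close> over the circle \<open>z + e\<^sup>i\<^sup>t w\<close>.  Integrate over \<open>w\<close> in the ball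
  about \<open>0\<close> and exchange the integrals: for every fixed \<open>t\<close> the rotation by \<open>e\<^sup>i\<^sup>t\<close> leaves the
  integral over the ball unchanged.
\<close>

lemma holomorphic2_submean:
  assumes f: "holomorphic2_on f \<Omega>" "open \<Omega>" and sub: "ball z r \<subseteq> \<Omega>"
  shows "ennreal ((cmod (f z))\<^sup>2) * emeasure lborel (ball z r)
    \<le> (\<integral>\<^sup>+w\<in>ball z r. ennreal ((cmod (f w))\<^sup>2) \<partial>lborel)"
proof -
  define G where "G w = ennreal (indicator (ball z r) w * (cmod (f w))\<^sup>2)" for w
  have "continuous_on (ball z r) (\<lambda>w. (cmod (f w))\<^sup>2)"
    using holomorphic2_on_imp_continuous_on[OF f(1)] sub
    by (intro continuous_intros) (auto intro: continuous_on_subset)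
  then have [measurable]: "G \<in> borel_measurable borel"
    unfolding G_def using borel_measurable_continuous_on_indicator[of "ball z r" "\<lambda>w. (cmod (f w))\<^sup>2"]
    by simp
  \<comment> \<open>the rotation of \<open>w\<close> by the angle \<open>t\<close>, moved to centre \<open>z\<close>\<close>
  define T where "T t w = (fst z + cis t * fst w, snd z + cis t * snd w)" for t and w :: "complex \<times> complex"
  have [measurable]: "(\<lambda>(t, w). T t w) \<in> borel_measurable (borel \<Otimes>\<^sub>M borel)"
    unfolding T_def borel_prod case_prod_beta
    by (intro borel_measurable_continuous_onI continuous_intros)
  let ?I = "\<integral>\<^sup>+w. G w \<partial>lborel"
  have rot: "(\<integral>\<^sup>+w. G (T t w) \<partial>lborel) = ?I" for t
  proof -
    have "(\<integral>\<^sup>+w. G (T t w) \<partial>lborel) = (\<integral>\<^sup>+w. (\<lambda>w. G (w + z)) (cis t * fst w, cis t * snd w) \<partial>lborel)"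
      by (simp add: T_def plus_prod_def add.commute)
    also have "\<dots> = (\<integral>\<^sup>+w. G (w + z) \<partial>lborel)"
      by (intro nn_integral_rotate2) auto
    finally show ?thesis
      by (simp add: nn_integral_lborel_translate)
  qed
  have circ: "ennreal (2 * pi * (cmod (f z))\<^sup>2) * indicator (ball (0 :: complex \<times> complex) r) w
      \<le> (\<integral>\<^sup>+t. indicator {0..2 * pi} t * G (T t w) \<partial>lborel)" for w
  proof (cases "w \<in> ball (0 :: complex \<times> complex) r")
    case True
    let ?g = "\<lambda>x. (f (fst z + x * fst w, snd z + x * snd w))\<^sup>2"
    have small: "cmod x * norm w < r" if "cmod x \<le> 1" for x
      using True that mult_right_mono[of "cmod x" 1 "norm w"] by auto
    have "?g holomorphic_on cball 0 1"
      using small by (intro holomorphic_on_power holomorphic_on_line[OF f sub]) auto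
    from circle_submean[OF this]
    have "ennreal (2 * pi * (cmod (f z))\<^sup>2)
        \<le> (\<integral>\<^sup>+t. indicator {0..2 * pi} t * ennreal (cmod (?g (cis t))) \<partial>lborel)"
      by (simp add: norm_power)
    also have "\<dots> = (\<integral>\<^sup>+t. indicator {0..2 * pi} t * G (T t w) \<partial>lborel)"
      using line_in_ball[OF small] by (intro nn_integral_cong) (simp add: G_def T_def norm_power)
    finally show ?thesis
      using True by simp
  qed auto
  have "ennreal (2 * pi * (cmod (f z))\<^sup>2) * emeasure lborel (ball (0 :: complex \<times> complex) r)
      = (\<integral>\<^sup>+w. ennreal (2 * pi * (cmod (f z))\<^sup>2) * indicator (ball (0 :: complex \<times> complex) r) w \<partial>lborel)"
    by (simp add: nn_integral_cmult_indicator)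
  also have "\<dots> \<le> (\<integral>\<^sup>+w. \<integral>\<^sup>+t. indicator {0..2 * pi} t * G (T t w) \<partial>lborel \<partial>lborel)"
    by (intro nn_integral_mono circ)
  also have "\<dots> = (\<integral>\<^sup>+t. \<integral>\<^sup>+w. indicator {0..2 * pi} t * G (T t w) \<partial>lborel \<partial>lborel)"
    by (rule lborel_pair.Fubini') measurable
  also have "\<dots> = (\<integral>\<^sup>+t. indicator {0..2 * pi} t * ?I \<partial>lborel)"
    by (simp add: nn_integral_cmult rot)
  also have "\<dots> = ennreal (2 * pi) * ?I"
    by (simp add: nn_integral_multc)
  finally have "ennreal (2 * pi) * (ennreal ((cmod (f z))\<^sup>2) * emeasure lborel (ball (0 :: complex \<times> complex) r)) \<le> ennreal (2 * pi) * ?I"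
    by (simp add: ennreal_mult' mult.assoc)
  then have "ennreal ((cmod (f z))\<^sup>2) * emeasure lborel (ball (0 :: complex \<times> complex) r) \<le> ?I"
    by (subst (asm) ennreal_mult_le_mult_iff) auto
  moreover have "emeasure lborel (ball (0 :: complex \<times> complex) r) = emeasure lborel (ball z r)"
  proof -
    have "emeasure lborel (ball z r) = (\<integral>\<^sup>+w. indicator (ball z r) (w + z) \<partial>lborel)"
      by (subst nn_integral_lborel_translate) (auto intro!: borel_measurable_indicator)
    also have "\<dots> = (\<integral>\<^sup>+w. indicator (ball (0 :: complex \<times> complex) r) w \<partial>lborel)"
      by (intro nn_integral_cong) (auto simp: indicator_def dist_norm)
    finally show ?thesis by simp
  qed
  moreover have "G w = ennreal ((cmod (f w))\<^sup>2) * indicator (ball z r) w" for w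
    by (auto simp: G_def indicator_def)
  ultimately show ?thesis by simp
qed

text \<open>
  Cauchy's inequality on the discs of radius \<open>r / 2\<close> in the two coordinate directions; half the radius
  keeps the closed discs inside the open ball.
\<close>

lemma holomorphic2_partial_bound:
  assumes f: "holomorphic2_on f \<Omega>" "open \<Omega>" and sub: "ball z r \<subseteq> \<Omega>" "r > 0"
    and bd: "\<And>w. w \<in> ball z r \<Longrightarrow> cmod (f w) \<le> B"
    and D: "(f has_derivative (\<lambda>h. a * fst h + b * snd h)) (at z)"
  shows "cmod a \<le> 2 * B / r" "cmod b \<le> 2 * B / r"
proof -
  have key: "cmod (a * fst v + b * snd v) \<le> 2 * B / r" if v: "norm v = 1" for v
  proof -
    let ?g = "\<lambda>x. f (fst z + x * fst v, snd z + x * snd v)"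
    have hol: "?g holomorphic_on cball 0 (r / 2)"
      using sub v by (intro holomorphic_on_line[OF f sub(1)]) auto
    have "cmod ((deriv ^^ 1) ?g 0) \<le> fact 1 * B / (r / 2) ^ 1"
    proof (rule Cauchy_inequality)
      show "?g holomorphic_on ball 0 (r / 2)"
        using hol by (rule holomorphic_on_subset) auto
      show "continuous_on (cball 0 (r / 2)) ?g"
        using hol by (rule holomorphic_on_imp_continuous_on)
      show "cmod (?g x) \<le> B" if "cmod (0 - x) = r / 2" for x
        using that sub v by (intro bd line_in_ball) auto
    qed (use sub in auto)
    moreover have "deriv ?g 0 = a * fst v + b * snd v"
      using D by (intro DERIV_imp_deriv has_field_derivative_along_line) simp
    ultimately show ?thesis
      by (simp add: field_simps)
  qed
  show "cmod a \<le> 2 * B / r" "cmod b \<le> 2 * B / r"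
    using key[of "(1, 0)"] key[of "(0, 1)"] by auto
qed

section \<open>Complete spaces of square integrable functions\<close>

text \<open>
  The functions are not identified when they agree almost everywhere, so \<open>l2_sq\<close> is the square of a
  seminorm only.
\<close>

definition sq_integrable :: "'a measure \<Rightarrow> ('a \<Rightarrow> complex) set" where
  "sq_integrable M = {f \<in> borel_measurable M. integrable M (\<lambda>z. (cmod (f z))\<^sup>2)}"

definition l2_inner :: "'a measure \<Rightarrow> ('a \<Rightarrow> complex) \<Rightarrow> ('a \<Rightarrow> complex) \<Rightarrow> complex" where
  "l2_inner M f g = (\<integral>z. f z * cnj (g z) \<partial>M)"

definition l2_sq :: "'a measure \<Rightarrow> ('a \<Rightarrow> complex) \<Rightarrow> real" where
  "l2_sq M f = (\<integral>z. (cmod (f z))\<^sup>2 \<partial>M)"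

lemma borel_measurable_cnj [measurable (raw)]:
  "f \<in> borel_measurable M \<Longrightarrow> (\<lambda>z. cnj (f z)) \<in> borel_measurable M"
  by (rule borel_measurable_continuous_on[of cnj]) (intro continuous_intros)

lemma sq_integrable_mult_cnj:
  assumes "f \<in> sq_integrable M" "g \<in> sq_integrable M"
  shows "integrable M (\<lambda>z. f z * cnj (g z))"
proof (rule Bochner_Integration.integrable_bound)
  show "integrable M (\<lambda>z. (cmod (f z))\<^sup>2 + (cmod (g z))\<^sup>2)"
    using assms by (auto simp: sq_integrable_def)
  show "(\<lambda>z. f z * cnj (g z)) \<in> borel_measurable M"
    using assms by (auto simp: sq_integrable_def)
  have "a * b \<le> a\<^sup>2 + b\<^sup>2" if "a \<ge> 0" "b \<ge> 0" for a b :: real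
    using that sum_squares_bound[of a b] mult_nonneg_nonneg[OF that] by linarith
  then show "AE z in M. norm (f z * cnj (g z)) \<le> norm ((cmod (f z))\<^sup>2 + (cmod (g z))\<^sup>2)"
    by (auto simp: norm_mult)
qed

lemma cmod_sq_add_cmul:
  "(cmod (x + c * y))\<^sup>2 = (cmod x)\<^sup>2 + 2 * Re (cnj c * (x * cnj y)) + (cmod c)\<^sup>2 * (cmod y)\<^sup>2"
  unfolding cmod_power2 by (simp add: power2_eq_square algebra_simps)

lemma
  assumes f: "f \<in> sq_integrable M" and g: "g \<in> sq_integrable M"
  shows sq_integrable_add_cmul: "(\<lambda>z. f z + c * g z) \<in> sq_integrable M"
    and l2_sq_add_cmul: "l2_sq M (\<lambda>z. f z + c * g z)
      = l2_sq M f + 2 * Re (cnj c * l2_inner M f g) + (cmod c)\<^sup>2 * l2_sq M g"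
proof -
  note int = sq_integrable_mult_cnj[OF f g]
  define X where "X z = Re (cnj c * (f z * cnj (g z)))" for z
  have X: "integrable M X"
    unfolding X_def by (intro integrable_Re integrable_mult_right int)
  have f': "integrable M (\<lambda>z. (cmod (f z))\<^sup>2)" and g': "integrable M (\<lambda>z. (cmod c)\<^sup>2 * (cmod (g z))\<^sup>2)"
    using f g by (auto simp: sq_integrable_def)
  have expand: "(cmod (f z + c * g z))\<^sup>2 = (cmod (f z))\<^sup>2 + 2 * X z + (cmod c)\<^sup>2 * (cmod (g z))\<^sup>2" for z
    unfolding X_def by (rule cmod_sq_add_cmul)
  have "integrable M (\<lambda>z. (cmod (f z + c * g z))\<^sup>2)"
    unfolding expand by (intro Bochner_Integration.integrable_add integrable_mult_right[OF X] f' g')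
  then show "(\<lambda>z. f z + c * g z) \<in> sq_integrable M"
    using f g by (auto simp: sq_integrable_def)
  have "Re (cnj c * l2_inner M f g) = (\<integral>z. X z \<partial>M)"
    unfolding l2_inner_def X_def integral_mult_right_zero[symmetric]
    by (rule integral_Re[symmetric]) (intro integrable_mult_right int)
  then show "l2_sq M (\<lambda>z. f z + c * g z)
      = l2_sq M f + 2 * Re (cnj c * l2_inner M f g) + (cmod c)\<^sup>2 * l2_sq M g"
    unfolding l2_sq_def expand using X f' g' by simp
qed

lemma l2_inner_add_cmul:
  assumes "f \<in> sq_integrable M" "g \<in> sq_integrable M" "h \<in> sq_integrable M"
  shows "l2_inner M (\<lambda>z. f z + c * g z) h = l2_inner M f h + c * l2_inner M g h"
proof -
  have "(f z + c * g z) * cnj (h z) = f z * cnj (h z) + c * (g z * cnj (h z))" for z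
    by (simp add: algebra_simps)
  then show ?thesis
    unfolding l2_inner_def using assms by (simp add: sq_integrable_mult_cnj)
qed

lemma l2_inner_commute: "l2_inner M g f = cnj (l2_inner M f g)"
  unfolding l2_inner_def by (subst Bochner_Integration.integral_cnj[symmetric]) (simp add: mult.commute)

lemma l2_sq_nonneg: "l2_sq M f \<ge> 0"
  by (simp add: l2_sq_def)

lemma l2_inner_self: "l2_inner M f f = of_real (l2_sq M f)"
  unfolding l2_inner_def l2_sq_def by (simp add: complex_norm_square[symmetric] flip: of_real_power)

lemma l2_cauchy_schwarz:
  assumes f: "f \<in> sq_integrable M" and g: "g \<in> sq_integrable M"
  shows "(cmod (l2_inner M f g))\<^sup>2 \<le> l2_sq M f * l2_sq M g"
proof -
  define p where "p = l2_inner M f g"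
  have *: "0 \<le> l2_sq M f - 2 * s * (cmod p)\<^sup>2 + s\<^sup>2 * (cmod p)\<^sup>2 * l2_sq M g" for s
  proof -
    \<comment> \<open>the phase of \<open>p\<close> in the coefficient makes the mixed term real and negative\<close>
    have "0 \<le> l2_sq M (\<lambda>z. f z + (- of_real s * p) * g z)"
      by (rule l2_sq_nonneg)
    also have "\<dots> = l2_sq M f + 2 * Re (cnj (- of_real s * p) * p)
        + (cmod (- of_real s * p))\<^sup>2 * l2_sq M g"
      unfolding p_def by (rule l2_sq_add_cmul[OF f g])
    also have "Re (cnj (- of_real s * p) * p) = - s * (cmod p)\<^sup>2"
      unfolding cmod_power2 by (simp add: power2_eq_square algebra_simps)
    finally show ?thesis
      by (simp add: norm_mult power_mult_distrib)
  qed
  show ?thesis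
  proof (cases "l2_sq M g = 0")
    case True
    have "cmod p = 0"
    proof (rule ccontr)
      assume "cmod p \<noteq> 0"
      then show False
        using *[of "(l2_sq M f + 1) / (2 * (cmod p)\<^sup>2)"] True by (simp add: field_simps)
    qed
    then show ?thesis
      using True by (simp add: p_def)
  next
    case False
    then have "l2_sq M g > 0"
      using l2_sq_nonneg[of M g] by simp
    then show ?thesis
      using *[of "1 / l2_sq M g"] by (simp add: p_def field_simps power2_eq_square)
  qed
qed

lemma nn_integral_l2_sq:
  assumes "f \<in> sq_integrable M"
  shows "(\<integral>\<^sup>+z. ennreal ((cmod (f z))\<^sup>2) \<partial>M) = ennreal (l2_sq M f)"
  unfolding l2_sq_def using assms by (intro nn_integral_eq_integral) (auto simp: sq_integrable_def)

text \<open>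
  Fatou's lemma in the form that lets a pointwise limit of square integrable functions inherit a bound.
\<close>

lemma l2_Fatou:
  assumes f: "\<And>n. f n \<in> sq_integrable M"
    and lim: "\<And>z. z \<in> space M \<Longrightarrow> (\<lambda>n. f n z) \<longlonglongrightarrow> g z"
    and bd: "\<forall>\<^sub>F n in sequentially. l2_sq M (f n) \<le> e"
  shows "g \<in> sq_integrable M" "l2_sq M g \<le> e"
proof -
  have [measurable]: "f n \<in> borel_measurable M" for n
    using f by (simp add: sq_integrable_def)
  have g [measurable]: "g \<in> borel_measurable M"
    by (rule borel_measurable_LIMSEQ_metric[OF _ lim]) auto
  obtain n where "l2_sq M (f n) \<le> e"
    using eventually_happens[OF bd] by auto
  then have e: "0 \<le> e"
    using l2_sq_nonneg[of M "f n"] by linarith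
  have "(\<integral>\<^sup>+z. ennreal ((cmod (g z))\<^sup>2) \<partial>M)
      = (\<integral>\<^sup>+z. liminf (\<lambda>n. ennreal ((cmod (f n z))\<^sup>2)) \<partial>M)"
  proof (rule nn_integral_cong)
    fix z assume "z \<in> space M"
    then have "(\<lambda>n. ennreal ((cmod (f n z))\<^sup>2)) \<longlonglongrightarrow> ennreal ((cmod (g z))\<^sup>2)"
      by (intro tendsto_ennrealI tendsto_intros lim)
    then show "ennreal ((cmod (g z))\<^sup>2) = liminf (\<lambda>n. ennreal ((cmod (f n z))\<^sup>2))"
      by (rule lim_imp_Liminf[OF trivial_limit_sequentially, symmetric])
  qed
  also have "\<dots> \<le> liminf (\<lambda>n. \<integral>\<^sup>+z. ennreal ((cmod (f n z))\<^sup>2) \<partial>M)"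
    by (rule nn_integral_liminf) measurable
  also have "\<dots> = liminf (\<lambda>n. ennreal (l2_sq M (f n)))"
    by (simp add: nn_integral_l2_sq f)
  also have "\<dots> \<le> ennreal e"
    by (rule Liminf_le) (use bd in \<open>auto elim!: eventually_mono intro: ennreal_leI\<close>)
  finally have le: "(\<integral>\<^sup>+z. ennreal ((cmod (g z))\<^sup>2) \<partial>M) \<le> ennreal e" .
  then have "integrable M (\<lambda>z. (cmod (g z))\<^sup>2)"
    by (intro integrableI_nonneg) (auto intro: le_less_trans)
  then show gs: "g \<in> sq_integrable M"
    by (simp add: sq_integrable_def)
  show "l2_sq M g \<le> e"
    using le e by (simp add: nn_integral_l2_sq[OF gs])
qed

definition l2_complete :: "'a measure \<Rightarrow> ('a \<Rightarrow> complex) set \<Rightarrow> bool" where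
  "l2_complete M H \<longleftrightarrow>
    (\<forall>f. (\<forall>n. f n \<in> H) \<longrightarrow>
       (\<forall>e>0. \<exists>N. \<forall>m\<ge>N. \<forall>n\<ge>N. l2_sq M (\<lambda>z. f m z - f n z) < e) \<longrightarrow>
       (\<exists>g\<in>H. (\<lambda>n. l2_sq M (\<lambda>z. f n z - g z)) \<longlonglongrightarrow> 0))"

text \<open>
  Riesz representation on a complete linear space \<open>H\<close> of square integrable functions.  The
  representing vector minimises \<open>J f = \<parallel>f\<parallel>\<^sup>2 - 2 Re (\<phi> f)\<close>: a minimising sequence is Cauchy by the
  parallelogram law, and the first variation of \<open>J\<close> at its limit \<open>k\<close> in direction \<open>h\<close> is
  \<open>2 (Re \<langle>h, k\<rangle> - Re (\<phi> h))\<close>, which has to vanish.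
\<close>

lemma l2_riesz:
  assumes H: "H \<subseteq> sq_integrable M" "H \<noteq> {}"
    and lin: "\<And>f g c. f \<in> H \<Longrightarrow> g \<in> H \<Longrightarrow> (\<lambda>z. f z + c * g z) \<in> H"
    and complete: "l2_complete M H"
    and phi_lin: "\<And>f g c. f \<in> H \<Longrightarrow> g \<in> H \<Longrightarrow> \<phi> (\<lambda>z. f z + c * g z) = \<phi> f + c * \<phi> g"
    and "C \<ge> 0"
    and phi_bd: "\<And>f. f \<in> H \<Longrightarrow> (cmod (\<phi> f))\<^sup>2 \<le> C * l2_sq M f"
  shows "\<exists>k\<in>H. \<forall>g\<in>H. \<phi> g = l2_inner M g k"
proof -
  define J where "J f = l2_sq M f - 2 * Re (\<phi> f)" for f
  have J_expand: "J (\<lambda>z. f z + of_real t * h z)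
      = J f + 2 * t * (Re (l2_inner M h f) - Re (\<phi> h)) + t\<^sup>2 * l2_sq M h" if "f \<in> H" "h \<in> H" for f h t
    using that H(1) l2_inner_commute[of M h f]
    by (simp add: J_def subset_iff l2_sq_add_cmul phi_lin algebra_simps)
  have J_lower: "J f \<ge> - C" if "f \<in> H" for f
  proof -
    define N where "N = l2_sq M f"
    have "N \<ge> 0" by (simp add: N_def l2_sq_nonneg)
    have "(Re (\<phi> f))\<^sup>2 \<le> C * N"
      using phi_bd[OF that] by (simp add: N_def cmod_power2) (smt (verit) zero_le_power2)
    moreover have "4 * (C * N) \<le> (C + N)\<^sup>2"
      using zero_le_power2[of "C - N"] by (simp add: power2_eq_square algebra_simps)
    ultimately have "(2 * Re (\<phi> f))\<^sup>2 \<le> (C + N)\<^sup>2"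
      by (simp add: power_mult_distrib)
    moreover have "C + N \<ge> 0"
      using \<open>N \<ge> 0\<close> \<open>C \<ge> 0\<close> by simp
    ultimately have "2 * Re (\<phi> f) \<le> C + N"
      by (rule power2_le_imp_le)
    then show ?thesis by (simp add: J_def N_def)
  qed
  define m where "m = Inf (J ` H)"
  have bdd: "bdd_below (J ` H)"
    using J_lower by (intro bdd_belowI[of _ "- C"]) auto
  have m_le: "m \<le> J f" if "f \<in> H" for f
    unfolding m_def using that bdd by (intro cInf_lower) auto
  have "\<exists>g\<in>H. J g < m + 1 / Suc n" for n
  proof -
    have "Inf (J ` H) < m + 1 / Suc n"
      by (simp add: m_def)
    then show ?thesis
      using cInf_less_iff[of "J ` H"] H(2) bdd by auto
  qed
  then obtain g where g: "\<And>n. g n \<in> H" "\<And>n. J (g n) < m + 1 / Suc n"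
    by metis
  have close: "l2_sq M (\<lambda>z. g i z - g j z) \<le> 2 / Suc i + 2 / Suc j" for i j
  proof -
    \<comment> \<open>\<open>J\<close> at the midpoint of \<open>g i\<close> and \<open>g j\<close> is at least \<open>m\<close>, which limits their distance\<close>
    let ?h = "\<lambda>z. g i z + (- 1) * g j z"
    have h: "?h \<in> H"
      using lin g by blast
    have "J (\<lambda>z. g j z + of_real 1 * ?h z) = J (g i)"
      by (simp add: algebra_simps)
    moreover have "(\<lambda>z. g j z + of_real (1/2) * ?h z) \<in> H"
      using lin g h by blast
    then have "m \<le> J (\<lambda>z. g j z + of_real (1/2) * ?h z)"
      by (rule m_le)
    ultimately have "l2_sq M ?h \<le> 2 * J (g i) + 2 * J (g j) - 4 * m"
      using J_expand[OF g(1) h, of j 1] J_expand[OF g(1) h, of j "1/2"]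
      by (simp add: power2_eq_square)
    then show ?thesis
      using g(2)[of i] g(2)[of j] by simp
  qed
  have "\<exists>N. \<forall>i\<ge>N. \<forall>j\<ge>N. l2_sq M (\<lambda>z. g i z - g j z) < e" if "e > 0" for e
  proof -
    have "0 < e / 4" using that by simp
    from reals_Archimedean[OF this] obtain N where N: "inverse (real (Suc N)) < e / 4"
      by blast
    have "l2_sq M (\<lambda>z. g i z - g j z) < e" if "i \<ge> N" "j \<ge> N" for i j
    proof -
      have "1 / real (Suc i) \<le> inverse (real (Suc N))" "1 / real (Suc j) \<le> inverse (real (Suc N))"
        using that by (auto simp: field_simps)
      then show ?thesis
        using close[of i j] N by simp
    qed
    then show ?thesis by blast
  qed
  then obtain k where k: "k \<in> H" and lim: "(\<lambda>n. l2_sq M (\<lambda>z. g n z - k z)) \<longlonglongrightarrow> 0"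
    using complete g(1) unfolding l2_complete_def by blast
  have Re_eq: "Re (l2_inner M h k) = Re (\<phi> h)" if h: "h \<in> H" for h
  proof -
    define A where "A = Re (l2_inner M h k) - Re (\<phi> h)"
    define D where "D n = l2_inner M (\<lambda>z. g n z + (- 1) * k z) h" for n
    have D_eq: "D n = l2_inner M (g n) h - l2_inner M k h" for n
      using l2_inner_add_cmul[of "g n" M k h "- 1"] g(1) k h H(1) by (auto simp: D_def subset_iff)
    have "(\<lambda>n. (cmod (D n))\<^sup>2) \<longlonglongrightarrow> 0"
    proof (rule tendsto_sandwich[OF _ _ tendsto_const])
      have "(cmod (D n))\<^sup>2 \<le> l2_sq M (\<lambda>z. g n z - k z) * l2_sq M h" for n
        using l2_cauchy_schwarz[of "\<lambda>z. g n z + (- 1) * k z" M h] lin[OF g(1) k, of n "- 1"] h H(1)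
        by (simp add: D_def subset_iff)
      then show "\<forall>\<^sub>F n in sequentially. (cmod (D n))\<^sup>2 \<le> l2_sq M (\<lambda>z. g n z - k z) * l2_sq M h"
        by simp
      show "(\<lambda>n. l2_sq M (\<lambda>z. g n z - k z) * l2_sq M h) \<longlonglongrightarrow> 0"
        using tendsto_mult_right[OF lim, of "l2_sq M h"] by simp
    qed simp
    then have "D \<longlonglongrightarrow> 0"
      by (simp add: tendsto_norm_zero_iff)
    then have "(\<lambda>n. Re (D n) + A) \<longlonglongrightarrow> Re 0 + A"
      by (intro tendsto_intros)
    then have A_lim: "(\<lambda>n. Re (l2_inner M h (g n)) - Re (\<phi> h)) \<longlonglongrightarrow> A"
      by (simp add: D_eq A_def l2_inner_commute[of M h])
    have nonneg: "0 \<le> 2 * t * A + t\<^sup>2 * l2_sq M h" for t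
    proof (rule tendsto_le)
      show "(\<lambda>n. 2 * t * (Re (l2_inner M h (g n)) - Re (\<phi> h)) + t\<^sup>2 * l2_sq M h)
          \<longlonglongrightarrow> 2 * t * A + t\<^sup>2 * l2_sq M h"
        by (intro tendsto_intros A_lim)
      show "(\<lambda>n. - (1 / real (Suc n))) \<longlonglongrightarrow> 0"
        using tendsto_minus[OF LIMSEQ_inverse_real_of_nat] by (simp add: inverse_eq_divide)
      have "- (1 / real (Suc n)) \<le> 2 * t * (Re (l2_inner M h (g n)) - Re (\<phi> h)) + t\<^sup>2 * l2_sq M h" for n
        using m_le[OF lin[OF g(1)[of n] h, of "of_real t"]] g(2)[of n] J_expand[OF g(1)[of n] h, of t]
        by simp
      then show "\<forall>\<^sub>F n in sequentially. - (1 / real (Suc n))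
          \<le> 2 * t * (Re (l2_inner M h (g n)) - Re (\<phi> h)) + t\<^sup>2 * l2_sq M h"
        by simp
    qed simp
    have "A = 0"
    proof (rule ccontr)
      assume "A \<noteq> 0"
      define d where "d = l2_sq M h + 1"
      have d: "d > 0" "l2_sq M h = d - 1"
        using l2_sq_nonneg[of M h] by (auto simp: d_def)
      \<comment> \<open>the parabola is negative at this \<open>t\<close>; the \<open>1\<close> in \<open>d\<close> covers the case \<open>l2_sq M h = 0\<close>\<close>
      have "0 \<le> 2 * (- A / d) * A + (- A / d)\<^sup>2 * (d - 1)"
        using nonneg[of "- A / d"] d by simp
      also have "\<dots> = - (A\<^sup>2 * (d + 1)) / d\<^sup>2"
        using d by (simp add: field_simps power2_eq_square)
      also have "\<dots> < 0"
        using d \<open>A \<noteq> 0\<close> by (simp add: divide_neg_pos)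
      finally show False by simp
    qed
    then show ?thesis by (simp add: A_def)
  qed
  have "\<phi> h = l2_inner M h k" if h: "h \<in> H" for h
  proof (rule complex_eqI)
    show "Re (\<phi> h) = Re (l2_inner M h k)"
      using Re_eq[OF h] by simp
    \<comment> \<open>the real part identity at \<open>\<i> h = h + (\<i> - 1) h\<close> is the imaginary part identity at \<open>h\<close>\<close>
    have hs: "h \<in> sq_integrable M" and ks: "k \<in> sq_integrable M"
      using h k H(1) by auto
    have "Re (l2_inner M h k + (\<i> - 1) * l2_inner M h k) = Re (\<phi> h + (\<i> - 1) * \<phi> h)"
      using Re_eq[OF lin[OF h h, of "\<i> - 1"]]
      unfolding phi_lin[OF h h] l2_inner_add_cmul[OF hs hs ks] .
    then show "Im (\<phi> h) = Im (l2_inner M h k)"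
      by (simp add: algebra_simps)
  qed
  then show ?thesis
    using k by blast
qed

section \<open>Completeness of the weighted Bergman space\<close>

lemma weighted_L2_eq: "weighted_L2 \<Omega> \<mu> = sq_integrable (weighted_measure \<Omega> \<mu>)"
  by (simp add: weighted_L2_def sq_integrable_def)

lemma space_weighted_measure [simp]: "space (weighted_measure \<Omega> \<mu>) = \<Omega>"
  by (simp add: weighted_measure_def)

lemma measurable_weighted_measure_eq [simp]:
  "measurable (weighted_measure \<Omega> \<mu>) N = measurable (lebesgue_on \<Omega>) N"
  by (simp add: weighted_measure_def measurable_density_eq1 cong: measurable_cong_sets)

lemma weighted_L2a_iff:
  "f \<in> weighted_L2a \<Omega> \<mu> \<longleftrightarrow> f \<in> sq_integrable (weighted_measure \<Omega> \<mu>) \<and> holomorphic2_on f \<Omega>"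
  by (simp add: weighted_L2a_def weighted_L2_eq)

lemma weighted_L2a_add_cmul:
  assumes "f \<in> weighted_L2a \<Omega> \<mu>" "g \<in> weighted_L2a \<Omega> \<mu>"
  shows "(\<lambda>z. f z + c * g z) \<in> weighted_L2a \<Omega> \<mu>"
  using assms by (simp add: weighted_L2a_iff sq_integrable_add_cmul holomorphic2_on_add_cmul)

lemma weighted_L2a_diff:
  assumes "f \<in> weighted_L2a \<Omega> \<mu>" "g \<in> weighted_L2a \<Omega> \<mu>"
  shows "(\<lambda>z. f z - g z) \<in> weighted_L2a \<Omega> \<mu>"
  using weighted_L2a_add_cmul[OF assms, of "- 1"] by simp

text \<open>
  The values of a member outside \<open>\<Omega>\<close> are arbitrary, so an integral formula for its values on \<open>\<Omega>\<close>
  defines a member again.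
\<close>

lemma weighted_L2a_cong:
  assumes f: "f \<in> weighted_L2a \<Omega> \<mu>" and eq: "\<And>z. z \<in> \<Omega> \<Longrightarrow> f z = g z"
  shows "g \<in> weighted_L2a \<Omega> \<mu>"
proof -
  have "g \<in> borel_measurable (weighted_measure \<Omega> \<mu>)"
    using f eq measurable_cong[of "weighted_measure \<Omega> \<mu>" f g borel]
    by (simp add: weighted_L2a_def weighted_L2_def)
  moreover have "integrable (weighted_measure \<Omega> \<mu>) (\<lambda>z. (cmod (g z))\<^sup>2)"
    using f eq Bochner_Integration.integrable_cong[OF refl, of "weighted_measure \<Omega> \<mu>"
        "\<lambda>z. (cmod (f z))\<^sup>2" "\<lambda>z. (cmod (g z))\<^sup>2"]
    by (simp add: weighted_L2a_def weighted_L2_def)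
  moreover have "holomorphic2_on g \<Omega>"
    unfolding holomorphic2_on_def
  proof
    fix z assume z: "z \<in> \<Omega>"
    then obtain a b where "(f has_derivative (\<lambda>h. a * fst h + b * snd h)) (at z within \<Omega>)"
      using f unfolding weighted_L2a_def holomorphic2_on_def by blast
    then have "(g has_derivative (\<lambda>h. a * fst h + b * snd h)) (at z within \<Omega>)"
      by (rule has_derivative_transform[OF z eq[symmetric], rotated])
    then show "\<exists>a b. (g has_derivative (\<lambda>h. a * fst h + b * snd h)) (at z within \<Omega>)"
      by blast
  qed
  ultimately show ?thesis
    by (simp add: weighted_L2a_def weighted_L2_def)
qed

locale weighted_domain =
  fixes \<Omega> :: "(complex \<times> complex) set" and \<mu> :: "complex \<times> complex \<Rightarrow> real"
  assumes open_domain: "open \<Omega>"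
    and continuous_weight: "continuous_on \<Omega> \<mu>"
    and weight_pos: "\<And>z. z \<in> \<Omega> \<Longrightarrow> \<mu> z > 0"
begin

abbreviation M where "M \<equiv> weighted_measure \<Omega> \<mu>"
abbreviation A where "A \<equiv> weighted_L2a \<Omega> \<mu>"

lemma nn_integral_weighted:
  assumes [measurable]: "F \<in> borel_measurable (lebesgue_on \<Omega>)"
  shows "(\<integral>\<^sup>+z. F z \<partial>M) = (\<integral>\<^sup>+z. ennreal (\<mu> z) * F z * indicator \<Omega> z \<partial>lborel)"
proof -
  have \<Omega>: "\<Omega> \<in> sets lebesgue"
    using open_domain by auto
  have [measurable]: "\<mu> \<in> borel_measurable (lebesgue_on \<Omega>)"
    using continuous_imp_measurable_on_sets_lebesgue[OF continuous_weight \<Omega>] .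
  have "(\<integral>\<^sup>+z. F z \<partial>M) = (\<integral>\<^sup>+z. ennreal (\<mu> z) * F z \<partial>lebesgue_on \<Omega>)"
    unfolding weighted_measure_def by (intro nn_integral_density) measurable
  also have "\<dots> = (\<integral>\<^sup>+z. ennreal (\<mu> z) * F z * indicator \<Omega> z \<partial>lebesgue)"
    using \<Omega> by (intro nn_integral_restrict_space) auto
  finally show ?thesis
    by (simp add: nn_integral_completion)
qed

lemma continuous_measurable:
  assumes "continuous_on \<Omega> f"
  shows "f \<in> borel_measurable (lebesgue_on \<Omega>)"
  using assms open_domain by (intro continuous_imp_measurable_on_sets_lebesgue) auto

text \<open>
  The weight is bounded below on a compact ball, so there the unweighted sub-mean value property
  passes to the weighted norm.  The ball has twice the radius, to leave room for a ball of radius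
  \<open>r\<close> about every point \<open>w\<close> considered.
\<close>

lemma local_value_bound:
  assumes z: "z \<in> \<Omega>"
  obtains r C where "r > 0" "C \<ge> 0" "ball z r \<subseteq> \<Omega>"
    "\<And>f w. f \<in> A \<Longrightarrow> w \<in> ball z r \<Longrightarrow> (cmod (f w))\<^sup>2 \<le> C * l2_sq M f"
proof -
  obtain R where R: "R > 0" "cball z R \<subseteq> \<Omega>"
    using open_domain z open_contains_cball by blast
  have "continuous_on (cball z R) \<mu>"
    using continuous_weight R(2) by (rule continuous_on_subset)
  then obtain p where p: "p \<in> cball z R" "\<And>w. w \<in> cball z R \<Longrightarrow> \<mu> p \<le> \<mu> w"
    using continuous_attains_inf[of "cball z R" \<mu>] R(1) by auto
  have c: "\<mu> p > 0"
    using weight_pos[of p] p(1) R(2) by blast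
  define r where "r = R / 2"
  have r: "r > 0" using R by (simp add: r_def)
  define v where "v = unit_ball_vol (real DIM(complex \<times> complex)) * r ^ DIM(complex \<times> complex)"
  have v: "v > 0" using r by (simp add: v_def)
  have vol: "emeasure lborel (ball w r) = ennreal v" for w :: "complex \<times> complex"
    unfolding v_def using r by (intro emeasure_ball) auto
  have "(cmod (f w))\<^sup>2 \<le> (1 / (v * \<mu> p)) * l2_sq M f" if f: "f \<in> A" and w: "w \<in> ball z r" for f w
  proof -
    have fs: "f \<in> sq_integrable M" and fh: "holomorphic2_on f \<Omega>"
      using f by (auto simp: weighted_L2a_iff)
    have "dist z x \<le> R" if "dist w x < r" for x
      using that w dist_triangle[of z x w] by (auto simp: r_def)
    then have sub: "ball w r \<subseteq> cball z R" by auto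
    have "ennreal ((cmod (f w))\<^sup>2) * ennreal v \<le> (\<integral>\<^sup>+x\<in>ball w r. ennreal ((cmod (f x))\<^sup>2) \<partial>lborel)"
      using holomorphic2_submean[OF fh open_domain, of w r] sub R(2) by (simp add: vol)
    then have "ennreal (\<mu> p) * (ennreal ((cmod (f w))\<^sup>2) * ennreal v)
        \<le> ennreal (\<mu> p) * (\<integral>\<^sup>+x\<in>ball w r. ennreal ((cmod (f x))\<^sup>2) \<partial>lborel)"
      by (rule mult_left_mono) simp
    also have "\<dots> = (\<integral>\<^sup>+x. ennreal (\<mu> p) * (ennreal ((cmod (f x))\<^sup>2) * indicator (ball w r) x) \<partial>lborel)"
    proof (rule nn_integral_cmult[symmetric])
      have "continuous_on (ball w r) (\<lambda>x. (cmod (f x))\<^sup>2)"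
        using holomorphic2_on_imp_continuous_on[OF fh] sub R(2)
        by (intro continuous_intros) (auto intro: continuous_on_subset)
      then have "(\<lambda>x. indicator (ball w r) x *\<^sub>R (cmod (f x))\<^sup>2) \<in> borel_measurable borel"
        by (intro borel_measurable_continuous_on_indicator) auto
      then have "(\<lambda>x. ennreal (indicator (ball w r) x *\<^sub>R (cmod (f x))\<^sup>2)) \<in> borel_measurable lborel"
        by (simp only: measurable_lborel2 measurable_compose[OF _ measurable_ennreal])
      moreover have "(\<lambda>x. ennreal (indicator (ball w r) x *\<^sub>R (cmod (f x))\<^sup>2))
          = (\<lambda>x. ennreal ((cmod (f x))\<^sup>2) * indicator (ball w r) x)"
        by (auto simp: fun_eq_iff indicator_def)
      ultimately show "(\<lambda>x. ennreal ((cmod (f x))\<^sup>2) * indicator (ball w r) x) \<in> borel_measurable lborel"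
        by (simp only:)
    qed
    also have "\<dots> \<le> (\<integral>\<^sup>+x. ennreal (\<mu> x) * ennreal ((cmod (f x))\<^sup>2) * indicator \<Omega> x \<partial>lborel)"
    proof (rule nn_integral_mono)
      fix x
      show "ennreal (\<mu> p) * (ennreal ((cmod (f x))\<^sup>2) * indicator (ball w r) x)
          \<le> ennreal (\<mu> x) * ennreal ((cmod (f x))\<^sup>2) * indicator \<Omega> x"
      proof (cases "x \<in> ball w r")
        case True
        then have "x \<in> cball z R" using sub by blast
        then have "x \<in> \<Omega>" "\<mu> p \<le> \<mu> x" using R(2) p(2) by blast+
        then show ?thesis
          using True by (auto intro!: mult_right_mono ennreal_leI)
      qed auto
    qed
    also have "\<dots> = (\<integral>\<^sup>+x. ennreal ((cmod (f x))\<^sup>2) \<partial>M)"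
      using fs by (intro nn_integral_weighted[symmetric]) (auto simp: sq_integrable_def)
    also have "\<dots> = ennreal (l2_sq M f)"
      by (rule nn_integral_l2_sq[OF fs])
    finally have "\<mu> p * ((cmod (f w))\<^sup>2 * v) \<le> l2_sq M f"
      using c v by (simp add: ennreal_mult[symmetric] l2_sq_nonneg)
    then show ?thesis
      using c v by (simp add: field_simps)
  qed
  moreover have "ball z r \<subseteq> \<Omega>"
    using R by (auto simp: r_def)
  moreover have "1 / (v * \<mu> p) \<ge> 0"
    using c v by simp
  ultimately show ?thesis
    using that[of r "1 / (v * \<mu> p)"] r by blast
qed

text \<open>
  The Cauchy estimates on balls of half the radius add derivatives to the value bound.
\<close>

lemma local_C1_bound:
  assumes z: "z \<in> \<Omega>"
  obtains r C where "r > 0" "C > 0" "ball z r \<subseteq> \<Omega>"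
    "\<And>f w. f \<in> A \<Longrightarrow> w \<in> ball z r \<Longrightarrow> cmod (f w) \<le> C * sqrt (l2_sq M f)"
    "\<And>f w a b. f \<in> A \<Longrightarrow> w \<in> ball z r \<Longrightarrow> (f has_derivative (\<lambda>h. a * fst h + b * snd h)) (at w)
       \<Longrightarrow> cmod a \<le> C * sqrt (l2_sq M f) \<and> cmod b \<le> C * sqrt (l2_sq M f)"
proof -
  obtain R c where R: "R > 0" "c \<ge> 0" "ball z R \<subseteq> \<Omega>"
    and bd: "\<And>f w. f \<in> A \<Longrightarrow> w \<in> ball z R \<Longrightarrow> (cmod (f w))\<^sup>2 \<le> c * l2_sq M f"
    using local_value_bound[OF z] by blast
  have bd': "cmod (f w) \<le> sqrt c * sqrt (l2_sq M f)" if "f \<in> A" "w \<in> ball z R" for f w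
    using bd[OF that] real_le_rsqrt by (simp add: real_sqrt_mult[symmetric])
  define r where "r = R / 2"
  define C where "C = 1 + sqrt c + 2 * sqrt c / r"
  have r: "r > 0" using R by (simp add: r_def)
  have C: "C > 0" "sqrt c \<le> C" "2 * sqrt c / r \<le> C"
    using r R(2) by (auto simp: C_def intro!: add_pos_nonneg)
  have scale: "x * sqrt (l2_sq M f) \<le> C * sqrt (l2_sq M f)" if "x \<le> C" for x f
    using that by (intro mult_right_mono) (auto simp: l2_sq_nonneg)
  have ball: "ball w r \<subseteq> ball z R" if "w \<in> ball z r" for w
  proof
    fix x assume "x \<in> ball w r"
    then show "x \<in> ball z R"
      using that dist_triangle[of z x w] by (auto simp: r_def)
  qed
  show ?thesis
  proof (rule that[of r C])
    show "ball z r \<subseteq> \<Omega>" using R by (auto simp: r_def)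
    show "cmod (f w) \<le> C * sqrt (l2_sq M f)" if "f \<in> A" "w \<in> ball z r" for f w
      using bd'[of f w] scale[OF C(2), of f] that ball[of w] r by force
    show "cmod a \<le> C * sqrt (l2_sq M f) \<and> cmod b \<le> C * sqrt (l2_sq M f)"
      if f: "f \<in> A" and w: "w \<in> ball z r"
        and D: "(f has_derivative (\<lambda>h. a * fst h + b * snd h)) (at w)" for f w a b
    proof -
      have fh: "holomorphic2_on f \<Omega>" and sub: "ball w r \<subseteq> \<Omega>"
        using f ball[OF w] R(3) by (auto simp: weighted_L2a_iff)
      have "cmod a \<le> 2 * (sqrt c * sqrt (l2_sq M f)) / r" "cmod b \<le> 2 * (sqrt c * sqrt (l2_sq M f)) / r"
        using holomorphic2_partial_bound[OF fh open_domain sub r bd'[OF f] D] ball[OF w] by blast+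
      then show ?thesis
        using scale[OF C(3), of f] by (auto simp: algebra_simps)
    qed
  qed (use r C in auto)
qed

text \<open>
  A Cauchy sequence converges pointwise, and its partial derivatives converge locally uniformly, by the
  local estimates for the differences \<open>f\<^sub>m - f\<^sub>n\<close>.  So the limit is differentiable and its derivative, the
  limit of complex linear maps, is complex linear.  Convergence in norm follows from Fatou's lemma.
\<close>

lemma weighted_L2a_complete: "l2_complete M A"
  unfolding l2_complete_def
proof (intro allI impI)
  fix f :: "nat \<Rightarrow> complex \<times> complex \<Rightarrow> complex"
  assume f: "\<forall>n. f n \<in> A" and Cauchy: "\<forall>e>0. \<exists>N. \<forall>m\<ge>N. \<forall>n\<ge>N. l2_sq M (\<lambda>z. f m z - f n z) < e"
  have Cauchy': "\<exists>N. \<forall>m\<ge>N. \<forall>n\<ge>N. C * sqrt (l2_sq M (\<lambda>z. f m z - f n z)) < e"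
    if "e > 0" "C > 0" for e C
  proof -
    have "(e / C)\<^sup>2 > 0" using that by simp
    then obtain N where N: "\<forall>m\<ge>N. \<forall>n\<ge>N. l2_sq M (\<lambda>z. f m z - f n z) < (e / C)\<^sup>2"
      using Cauchy by blast
    have "C * sqrt (l2_sq M (\<lambda>z. f m z - f n z)) < e" if "m \<ge> N" "n \<ge> N" for m n
    proof -
      have "sqrt (l2_sq M (\<lambda>z. f m z - f n z)) < e / C"
        using N that real_sqrt_less_mono[of "l2_sq M (\<lambda>z. f m z - f n z)" "(e / C)\<^sup>2"] \<open>e > 0\<close> \<open>C > 0\<close>
        by (simp only: real_sqrt_abs abs_of_pos divide_pos_pos)
      then show ?thesis using \<open>C > 0\<close> by (simp add: field_simps)
    qed
    then show ?thesis by blast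
  qed
  have diff: "(\<lambda>z. f m z - f n z) \<in> A" for m n
    using f weighted_L2a_diff by blast
  have "\<exists>l. (\<lambda>n. f n z) \<longlonglongrightarrow> l" if z: "z \<in> \<Omega>" for z
  proof -
    obtain r C where "r > 0" and C: "C > 0" and "ball z r \<subseteq> \<Omega>"
      and bd: "\<And>f w. f \<in> A \<Longrightarrow> w \<in> ball z r \<Longrightarrow> cmod (f w) \<le> C * sqrt (l2_sq M f)"
      by (rule local_C1_bound[OF z]) (rule that)
    have "Cauchy (\<lambda>n. f n z)"
    proof (rule metric_CauchyI)
      fix e :: real assume "e > 0"
      then obtain N where "\<forall>m\<ge>N. \<forall>n\<ge>N. C * sqrt (l2_sq M (\<lambda>z. f m z - f n z)) < e"
        using Cauchy' C by blast
      then have "\<forall>m\<ge>N. \<forall>n\<ge>N. dist (f m z) (f n z) < e"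
        using bd[OF diff, of z] \<open>r > 0\<close> unfolding dist_norm by (meson centre_in_ball le_less_trans)
      then show "\<exists>N. \<forall>m\<ge>N. \<forall>n\<ge>N. dist (f m z) (f n z) < e" by blast
    qed
    then show ?thesis
      by (simp add: Cauchy_convergent_iff convergent_def)
  qed
  then obtain g where g: "\<And>z. z \<in> \<Omega> \<Longrightarrow> (\<lambda>n. f n z) \<longlonglongrightarrow> g z"
    by metis
  have "holomorphic2_on g \<Omega>"
    unfolding holomorphic2_on_def
  proof
    fix z assume z: "z \<in> \<Omega>"
    obtain r C where r: "r > 0" and C: "C > 0" and sub: "ball z r \<subseteq> \<Omega>"
      and "\<And>f w. f \<in> A \<Longrightarrow> w \<in> ball z r \<Longrightarrow> cmod (f w) \<le> C * sqrt (l2_sq M f)"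
      and bd: "\<And>f w a b. f \<in> A \<Longrightarrow> w \<in> ball z r \<Longrightarrow> (f has_derivative (\<lambda>h. a * fst h + b * snd h)) (at w)
       \<Longrightarrow> cmod a \<le> C * sqrt (l2_sq M f) \<and> cmod b \<le> C * sqrt (l2_sq M f)"
      by (rule local_C1_bound[OF z]) (rule that)
    have "\<forall>n w. \<exists>p. w \<in> \<Omega> \<longrightarrow> (f n has_derivative (\<lambda>h. fst p * fst h + snd p * snd h)) (at w)"
    proof (intro allI)
      fix n w
      have hol: "holomorphic2_on (f n) \<Omega>"
        using f by (simp add: weighted_L2a_iff)
      show "\<exists>p. w \<in> \<Omega> \<longrightarrow> (f n has_derivative (\<lambda>h. fst p * fst h + snd p * snd h)) (at w)"
      proof (cases "w \<in> \<Omega>")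
        case True
        obtain a b where "(f n has_derivative (\<lambda>h. a * fst h + b * snd h)) (at w)"
          by (rule holomorphic2_on_has_derivative_at[OF hol open_domain True])
        then show ?thesis
          by (intro exI[of _ "(a, b)"]) simp
      qed simp
    qed
    then obtain p where p: "\<forall>n w. w \<in> \<Omega> \<longrightarrow>
        (f n has_derivative (\<lambda>h. fst (p n w) * fst h + snd (p n w) * snd h)) (at w)"
      unfolding choice_iff by blast
    define a b where "a n w = fst (p n w)" and "b n w = snd (p n w)" for n w
    have D: "(f n has_derivative (\<lambda>h. a n w * fst h + b n w * snd h)) (at w)" if "w \<in> \<Omega>" for n w
      unfolding a_def b_def using p that by blast
    have ab: "cmod (a m w - a n w) \<le> C * sqrt (l2_sq M (\<lambda>z. f m z - f n z))"
      "cmod (b m w - b n w) \<le> C * sqrt (l2_sq M (\<lambda>z. f m z - f n z))"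
      if w: "w \<in> ball z r" for m n w
    proof -
      have "((\<lambda>z. f m z - f n z) has_derivative
          (\<lambda>h. (a m w * fst h + b m w * snd h) - (a n w * fst h + b n w * snd h))) (at w)"
        using D sub w by (intro has_derivative_diff) blast+
      then have "((\<lambda>z. f m z - f n z) has_derivative
          (\<lambda>h. (a m w - a n w) * fst h + (b m w - b n w) * snd h)) (at w)"
        by (simp add: algebra_simps)
      from bd[OF diff w this]
      show "cmod (a m w - a n w) \<le> C * sqrt (l2_sq M (\<lambda>z. f m z - f n z))"
        "cmod (b m w - b n w) \<le> C * sqrt (l2_sq M (\<lambda>z. f m z - f n z))"
        by auto
    qed
    have Cauchy_ab: "uniformly_Cauchy_on (ball z r) u"
      if u: "\<And>m n w. w \<in> ball z r \<Longrightarrow> cmod (u m w - u n w) \<le> C * sqrt (l2_sq M (\<lambda>z. f m z - f n z))" for u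
      unfolding uniformly_Cauchy_on_def dist_norm
    proof (intro allI impI)
      fix e :: real assume "e > 0"
      then obtain N where N: "\<forall>m\<ge>N. \<forall>n\<ge>N. C * sqrt (l2_sq M (\<lambda>z. f m z - f n z)) < e"
        using Cauchy' C by blast
      have "cmod (u m x - u n x) < e" if "x \<in> ball z r" "m \<ge> N" "n \<ge> N" for x m n
        using le_less_trans[OF u[OF that(1)]] N that by blast
      then show "\<exists>N. \<forall>x\<in>ball z r. \<forall>m\<ge>N. \<forall>n\<ge>N. cmod (u m x - u n x) < e" by blast
    qed
    have "uniformly_convergent_on (ball z r) a"
      by (intro Cauchy_uniformly_convergent Cauchy_ab) (rule ab(1))
    then obtain a' where a': "uniform_limit (ball z r) a a' sequentially"
      by (auto simp: uniformly_convergent_on_def)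
    have "uniformly_convergent_on (ball z r) b"
      by (intro Cauchy_uniformly_convergent Cauchy_ab) (rule ab(2))
    then obtain b' where b': "uniform_limit (ball z r) b b' sequentially"
      by (auto simp: uniformly_convergent_on_def)
    have "\<exists>G. \<forall>x\<in>ball z r. (\<lambda>n. f n x) \<longlonglongrightarrow> G x \<and>
        (G has_derivative (\<lambda>h. a' x * fst h + b' x * snd h)) (at x within ball z r)"
    proof (rule has_derivative_sequence[where f' = "\<lambda>n w h. a n w * fst h + b n w * snd h"])
      show "(f n has_derivative (\<lambda>h. a n x * fst h + b n x * snd h)) (at x within ball z r)"
        if "x \<in> ball z r" for n x
        using D that sub has_derivative_at_withinI by blast
      show "\<forall>\<^sub>F n in sequentially. \<forall>x\<in>ball z r. \<forall>h.
          cmod (a n x * fst h + b n x * snd h - (a' x * fst h + b' x * snd h)) \<le> e * norm h"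
        if "e > 0" for e
      proof -
        have e2: "e / 2 > 0" using that by simp
        have "\<forall>\<^sub>F n in sequentially. \<forall>x\<in>ball z r. dist (a n x) (a' x) < e / 2"
          "\<forall>\<^sub>F n in sequentially. \<forall>x\<in>ball z r. dist (b n x) (b' x) < e / 2"
          using uniform_limitD[OF a' e2] uniform_limitD[OF b' e2] .
        then show ?thesis
        proof eventually_elim
          case (elim n)
          show ?case
          proof (intro ballI allI)
            fix x and h :: "complex \<times> complex" assume x: "x \<in> ball z r"
            have "cmod (a n x * fst h + b n x * snd h - (a' x * fst h + b' x * snd h))
                = cmod ((a n x - a' x) * fst h + (b n x - b' x) * snd h)"
              by (simp add: algebra_simps)
            also have "\<dots> \<le> cmod (a n x - a' x) * cmod (fst h) + cmod (b n x - b' x) * cmod (snd h)"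
              by (metis norm_mult norm_triangle_ineq)
            also have "\<dots> \<le> e / 2 * norm h + e / 2 * norm h"
            proof (intro add_mono mult_mono)
              show "cmod (a n x - a' x) \<le> e / 2" "cmod (b n x - b' x) \<le> e / 2"
                using elim x unfolding dist_norm by (meson less_imp_le)+
              show "cmod (fst h) \<le> norm h" "cmod (snd h) \<le> norm h"
                using norm_fst_le[of "fst h" "snd h"] norm_snd_le[of "snd h" "fst h"] by simp_all
            qed (use e2 in auto)
            finally show "cmod (a n x * fst h + b n x * snd h - (a' x * fst h + b' x * snd h)) \<le> e * norm h"
              by simp
          qed
        qed
      qed
      show "z \<in> ball z r" using r by simp
      show "(\<lambda>n. f n z) \<longlonglongrightarrow> g z" using g z by simp
    qed simp
    then obtain G where G: "\<And>x. x \<in> ball z r \<Longrightarrow> (\<lambda>n. f n x) \<longlonglongrightarrow> G x"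
      "\<And>x. x \<in> ball z r \<Longrightarrow> (G has_derivative (\<lambda>h. a' x * fst h + b' x * snd h)) (at x within ball z r)"
      by blast
    have "G x = g x" if "x \<in> ball z r" for x
      using G(1)[OF that] g sub that LIMSEQ_unique by blast
    then have "(g has_derivative (\<lambda>h. a' z * fst h + b' z * snd h)) (at z within ball z r)"
      using G(2)[of z] r by (intro has_derivative_transform[of z "ball z r" g G]) auto
    then have "(g has_derivative (\<lambda>h. a' z * fst h + b' z * snd h)) (at z)"
      using r by (simp add: at_within_open[of z "ball z r"])
    then show "\<exists>a b. (g has_derivative (\<lambda>h. a * fst h + b * snd h)) (at z within \<Omega>)"
      using has_derivative_at_withinI by blast
  qed
  have L2_lim: "(\<lambda>z. f n z - g z) \<in> sq_integrable M \<and> l2_sq M (\<lambda>z. f n z - g z) \<le> e"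
    if N: "\<forall>m\<ge>N. \<forall>n\<ge>N. l2_sq M (\<lambda>z. f m z - f n z) < e" and n: "n \<ge> N" for e N n
  proof -
    have lim: "(\<lambda>m. f n z - f m z) \<longlonglongrightarrow> f n z - g z" if "z \<in> space M" for z
      using that g by (intro tendsto_intros) auto
    have ev: "\<forall>\<^sub>F m in sequentially. l2_sq M (\<lambda>z. f n z - f m z) \<le> e"
      unfolding eventually_sequentially using N n by (meson less_imp_le)
    have sq: "(\<lambda>z. f n z - f m z) \<in> sq_integrable M" for m
      using diff by (simp add: weighted_L2a_iff)
    show ?thesis
      using l2_Fatou[OF sq lim ev] by simp
  qed
  obtain N where "\<forall>m\<ge>N. \<forall>n\<ge>N. l2_sq M (\<lambda>z. f m z - f n z) < 1"
    using Cauchy zero_less_one by blast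
  \<comment> \<open>\<open>g = f\<^sub>N - (f\<^sub>N - g)\<close> is square integrable, since both terms are\<close>
  from L2_lim[OF this order_refl] have "(\<lambda>z. f N z - g z) \<in> sq_integrable M" by simp
  then have "(\<lambda>z. f N z + (- 1) * (f N z - g z)) \<in> sq_integrable M"
    using f by (intro sq_integrable_add_cmul) (auto simp: weighted_L2a_iff)
  then have "g \<in> A"
    using \<open>holomorphic2_on g \<Omega>\<close> by (simp add: weighted_L2a_iff)
  moreover have "(\<lambda>n. l2_sq M (\<lambda>z. f n z - g z)) \<longlonglongrightarrow> 0"
  proof (rule LIMSEQ_I)
    fix e :: real assume "e > 0"
    then have "e / 2 > 0" by simp
    then obtain N where "\<forall>m\<ge>N. \<forall>n\<ge>N. l2_sq M (\<lambda>z. f m z - f n z) < e / 2"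
      using Cauchy by blast
    then have le: "l2_sq M (\<lambda>z. f n z - g z) \<le> e / 2" if "n \<ge> N" for n
      using L2_lim that by blast
    have "norm (l2_sq M (\<lambda>z. f n z - g z) - 0) < e" if "n \<ge> N" for n
      using le[OF that] \<open>e > 0\<close> l2_sq_nonneg[of M "\<lambda>z. f n z - g z"] by simp
    then show "\<exists>N. \<forall>n\<ge>N. norm (l2_sq M (\<lambda>z. f n z - g z) - 0) < e"
      by blast
  qed
  ultimately show "\<exists>g\<in>A. (\<lambda>n. l2_sq M (\<lambda>z. f n z - g z)) \<longlonglongrightarrow> 0"
    by blast
qed
end

section \<open>The weighted Bergman kernel\<close>

context weighted_domain
begin

lemma zero_in_weighted_L2a: "(\<lambda>z. 0) \<in> A"
proof -
  have "holomorphic2_on (\<lambda>z. 0) \<Omega>"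
    unfolding holomorphic2_on_def by (intro ballI exI[of _ 0]) simp
  then show ?thesis
    by (simp add: weighted_L2a_iff sq_integrable_def)
qed

lemma weighted_L2a_riesz:
  assumes "\<And>f g c. f \<in> A \<Longrightarrow> g \<in> A \<Longrightarrow> \<phi> (\<lambda>z. f z + c * g z) = \<phi> f + c * \<phi> g"
    and "C \<ge> 0" and "\<And>f. f \<in> A \<Longrightarrow> (cmod (\<phi> f))\<^sup>2 \<le> C * l2_sq M f"
  shows "\<exists>k\<in>A. \<forall>g\<in>A. \<phi> g = l2_inner M g k"
  using assms zero_in_weighted_L2a weighted_L2a_complete weighted_L2a_add_cmul
  by (intro l2_riesz[where C = C]) (auto simp: weighted_L2a_iff)

text \<open>
  The projection of \<open>f\<close> represents the functional \<open>h \<mapsto> \<langle>h, f\<rangle>\<close>.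
\<close>

lemma projection_exists:
  assumes f: "f \<in> sq_integrable M"
  shows "\<exists>p\<in>A. \<forall>h\<in>A. l2_inner M h f = l2_inner M h p"
proof (rule weighted_L2a_riesz)
  show "(cmod (l2_inner M h f))\<^sup>2 \<le> l2_sq M f * l2_sq M h" if "h \<in> A" for h
    using l2_cauchy_schwarz[of h M f] that f by (simp add: weighted_L2a_iff mult.commute)
qed (use f in \<open>auto simp: l2_inner_add_cmul l2_sq_nonneg weighted_L2a_iff\<close>)

lemma evaluation_kernel_exists:
  assumes z: "z \<in> \<Omega>"
  shows "\<exists>k\<in>A. \<forall>h\<in>A. h z = l2_inner M h k"
proof -
  obtain r C where "r > 0" "C \<ge> 0" "ball z r \<subseteq> \<Omega>"
    and "\<And>f w. f \<in> A \<Longrightarrow> w \<in> ball z r \<Longrightarrow> (cmod (f w))\<^sup>2 \<le> C * l2_sq M f"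
    by (rule local_value_bound[OF z]) (rule that)
  then show ?thesis
    by (intro weighted_L2a_riesz[where C = C]) auto
qed

lemma bergman_kernel_exists: "\<exists>K. is_bergman_kernel \<Omega> \<mu> K"
proof -
  obtain k where k: "\<And>z. z \<in> \<Omega> \<Longrightarrow> k z \<in> A"
    and eval: "\<And>z h. z \<in> \<Omega> \<Longrightarrow> h \<in> A \<Longrightarrow> h z = l2_inner M h (k z)"
    using evaluation_kernel_exists by metis
  define K where "K z w = cnj (k z w)" for z w
  have "is_bergman_projection \<Omega> \<mu> f (\<lambda>z. \<integral>w. K z w * f w \<partial>M)" if f: "f \<in> sq_integrable M" for f
  proof -
    obtain p where p: "p \<in> A" and proj: "\<And>h. h \<in> A \<Longrightarrow> l2_inner M h f = l2_inner M h p"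
      using projection_exists[OF f] by blast
    have eq: "p z = (\<integral>w. K z w * f w \<partial>M)" if z: "z \<in> \<Omega>" for z
    proof -
      have "p z = cnj (l2_inner M (k z) p)"
        using eval[OF z p] l2_inner_commute by simp
      also have "\<dots> = cnj (l2_inner M (k z) f)"
        using proj[OF k[OF z]] by simp
      also have "\<dots> = l2_inner M f (k z)"
        by (rule l2_inner_commute[symmetric])
      finally show ?thesis
        by (simp add: l2_inner_def K_def mult.commute)
    qed
    have "(\<lambda>z. \<integral>w. K z w * f w \<partial>M) \<in> A"
      using weighted_L2a_cong[OF p eq] by simp
    moreover have "(\<integral>z. (f z - (\<integral>w. K z w * f w \<partial>M)) * cnj (h z) \<partial>M) = 0" if h: "h \<in> A" for h
    proof -
      have "(\<integral>z. (f z - (\<integral>w. K z w * f w \<partial>M)) * cnj (h z) \<partial>M) = l2_inner M (\<lambda>z. f z + (- 1) * p z) h"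
        unfolding l2_inner_def by (intro Bochner_Integration.integral_cong) (auto simp: eq)
      also have "\<dots> = l2_inner M f h - l2_inner M p h"
        using f p h l2_inner_add_cmul[of f M p h "- 1"] by (auto simp: weighted_L2a_iff)
      also have "\<dots> = 0"
        using proj[OF h] l2_inner_commute[of M f h] l2_inner_commute[of M p h] by simp
      finally show ?thesis .
    qed
    ultimately show ?thesis
      unfolding is_bergman_projection_def by blast
  qed
  then have "is_bergman_kernel \<Omega> \<mu> K"
    using k by (simp add: is_bergman_kernel_def weighted_L2_eq K_def)
  then show ?thesis by blast
qed

text \<open>
  Inside the Bergman space the projection is the identity: \<open>f - P f\<close> lies in the space and is
  orthogonal to itself, so its norm vanishes, and then so do its values, which the norm controls.
\<close>

lemma bergman_kernel_reproducing:
  assumes K: "is_bergman_kernel \<Omega> \<mu> K" and f: "f \<in> A" and z: "z \<in> \<Omega>"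
  shows "f z = l2_inner M f (\<lambda>w. cnj (K z w))"
proof -
  define g where "g z = (\<integral>w. K z w * f w \<partial>M)" for z
  have fs: "f \<in> sq_integrable M"
    using f by (simp add: weighted_L2a_iff)
  then have "is_bergman_projection \<Omega> \<mu> f g"
    using K unfolding is_bergman_kernel_def weighted_L2_eq g_def by blast
  then have g: "g \<in> A" and orth: "\<And>h. h \<in> A \<Longrightarrow> l2_inner M (\<lambda>z. f z - g z) h = 0"
    by (auto simp: is_bergman_projection_def l2_inner_def)
  have d: "(\<lambda>z. f z - g z) \<in> A"
    by (rule weighted_L2a_diff[OF f g])
  then have "l2_sq M (\<lambda>z. f z - g z) = 0"
    using orth[OF d] l2_inner_self[of M "\<lambda>z. f z - g z"] by simp
  moreover obtain r C where r: "r > 0" and "C \<ge> 0" "ball z r \<subseteq> \<Omega>"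
    and bd: "\<And>f w. f \<in> A \<Longrightarrow> w \<in> ball z r \<Longrightarrow> (cmod (f w))\<^sup>2 \<le> C * l2_sq M f"
    by (rule local_value_bound[OF z]) (rule that)
  ultimately have "(cmod (f z - g z))\<^sup>2 \<le> 0"
    using bd[OF d, of z] r by simp
  then show ?thesis
    by (simp add: g_def l2_inner_def mult.commute)
qed

text \<open>
  Applying the reproducing property to \<open>k\<^sub>z = cnj (K z \<cdot>)\<close> itself shows \<open>K z z = \<parallel>k\<^sub>z\<parallel>\<^sup>2\<close>, and
  \<open>f z = \<langle>f, k\<^sub>z\<rangle>\<close> is then bounded by the Cauchy-Schwarz inequality.
\<close>

theorem bergman_kernel_diagonal_bound:
  assumes f: "f \<in> A" and z: "z \<in> \<Omega>"
  shows "(cmod (f z))\<^sup>2 \<le> cmod (bergman_kernel \<Omega> \<mu> z z) * l2_sq M f"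
proof -
  define K where "K = bergman_kernel \<Omega> \<mu>"
  have K: "is_bergman_kernel \<Omega> \<mu> K"
    unfolding K_def bergman_kernel_def by (rule someI_ex[OF bergman_kernel_exists])
  define k where "k = (\<lambda>w. cnj (K z w))"
  have k: "k \<in> A"
    using K z unfolding is_bergman_kernel_def k_def by blast
  have rep: "h z = l2_inner M h k" if "h \<in> A" for h
    using bergman_kernel_reproducing[OF K that z] by (simp add: k_def)
  have "cmod (K z z) = cmod (k z)"
    by (simp add: k_def)
  also have "\<dots> = l2_sq M k"
    by (simp add: rep[OF k] l2_inner_self l2_sq_nonneg)
  finally have "cmod (K z z) = l2_sq M k" .
  then show ?thesis
    using l2_cauchy_schwarz[of f M k] f k rep[OF f]
    by (simp add: weighted_L2a_iff K_def mult.commute)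
qed

end

section \<open>The Hartogs triangle\<close>

interpretation hartogs: weighted_domain hartogs_triangle hartogs_weight
proof
  show "open hartogs_triangle"
    unfolding hartogs_triangle_def
    by (intro open_Collect_conj open_Collect_less continuous_intros)
  show "continuous_on hartogs_triangle hartogs_weight"
    unfolding hartogs_weight_def hartogs_triangle_def
    by (intro continuous_intros) auto
qed (simp add: hartogs_weight_def)

text \<open>
  This is \<open>(1 + x / n)\<^sup>n \<le> e\<^sup>x\<close> at \<open>x = 1 / s\<close>, with the summand \<open>1\<close> dropped.
\<close>

lemma exp_weight_kills_power:
  assumes "s > 0"
  shows "exp (- (1 / s)) * (1 / s) ^ n \<le> real n ^ n"
proof (cases "n = 0")
  case False
  have "(1 / s / real n) ^ n \<le> (1 + 1 / s / real n) ^ n"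
    using assms by (intro power_mono) auto
  also have "\<dots> \<le> exp (1 / s)"
    using assms False order.trans[of "- real n" 0 "1 / s"] by (intro exp_ge_one_plus_x_over_n_power_n) auto
  finally have "real n ^ n * (1 / s / real n) ^ n \<le> real n ^ n * exp (1 / s)"
    by (rule mult_left_mono) simp
  also have "real n ^ n * (1 / s / real n) ^ n = (1 / s) ^ n"
    using False by (simp flip: power_mult_distrib)
  finally have "(1 / s) ^ n \<le> real n ^ n * exp (1 / s)" .
  then have "exp (- (1 / s)) * (1 / s) ^ n \<le> exp (- (1 / s)) * (real n ^ n * exp (1 / s))"
    by (rule mult_left_mono) simp
  also have "\<dots> = real n ^ n"
    by (simp add: exp_minus)
  finally show ?thesis .
qed (use assms in simp)

lemma negative_power_in_hartogs_L2a:
  "(\<lambda>z. inverse (fst z) ^ N) \<in> weighted_L2a hartogs_triangle hartogs_weight"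
proof -
  let ?f = "\<lambda>z :: complex \<times> complex. inverse (fst z) ^ N"
  have nz: "fst z \<noteq> 0" if "z \<in> hartogs_triangle" for z
    using that by (auto simp: hartogs_triangle_def)
  have hol: "holomorphic2_on ?f hartogs_triangle"
    unfolding holomorphic2_on_def
  proof
    fix z assume "z \<in> hartogs_triangle"
    then have "(\<lambda>x. inverse x ^ N) field_differentiable at (fst z)"
      using nz by (intro derivative_intros field_differentiable_power field_differentiable_inverse) auto
    then obtain D where "((\<lambda>x. inverse x ^ N) has_derivative (*) D) (at (fst z))"
      by (auto simp: field_differentiable_def has_field_derivative_def)
    from has_derivative_compose[OF has_derivative_fst[OF has_derivative_ident] this]
    have "(?f has_derivative (\<lambda>h. D * fst h + 0 * snd h)) (at z within hartogs_triangle)"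
      by simp
    then show "\<exists>a b. (?f has_derivative (\<lambda>h. a * fst h + b * snd h)) (at z within hartogs_triangle)"
      by blast
  qed
  have meas [measurable]: "?f \<in> borel_measurable (lebesgue_on hartogs_triangle)"
    by (intro hartogs.continuous_measurable holomorphic2_on_imp_continuous_on hol)
  have "(\<integral>\<^sup>+z. ennreal ((cmod (?f z))\<^sup>2) \<partial>weighted_measure hartogs_triangle hartogs_weight)
      = (\<integral>\<^sup>+z. ennreal (hartogs_weight z) * ennreal ((cmod (?f z))\<^sup>2) * indicator hartogs_triangle z \<partial>lborel)"
    by (intro hartogs.nn_integral_weighted) measurable
  also have "\<dots> \<le> (\<integral>\<^sup>+z. ennreal (real (N * 2) ^ (N * 2)) * indicator hartogs_triangle z \<partial>lborel)"
  proof (intro nn_integral_mono)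
    fix z :: "complex \<times> complex"
    have "hartogs_weight z * (cmod (?f z))\<^sup>2 \<le> real (N * 2) ^ (N * 2)" if "z \<in> hartogs_triangle"
      using exp_weight_kills_power[of "cmod (fst z)" "N * 2"] nz[OF that]
      by (simp add: hartogs_weight_def norm_power norm_inverse norm_divide inverse_eq_divide power_mult[symmetric] del: of_nat_mult)
    then show "ennreal (hartogs_weight z) * ennreal ((cmod (?f z))\<^sup>2) * indicator hartogs_triangle z
        \<le> ennreal (real (N * 2) ^ (N * 2)) * indicator hartogs_triangle z"
      by (auto simp: indicator_def ennreal_mult[symmetric] hartogs_weight_def intro!: ennreal_leI)
  qed
  also have "\<dots> = ennreal (real (N * 2) ^ (N * 2)) * emeasure lborel hartogs_triangle"
    using hartogs.open_domain by (intro nn_integral_cmult_indicator) auto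
  also have "\<dots> < \<infinity>"
  proof -
    have "norm z \<le> 2" if "z \<in> hartogs_triangle" for z
      using that norm_Pair_le[of "fst z" "snd z"] by (auto simp: hartogs_triangle_def)
    then have "bounded hartogs_triangle"
      unfolding bounded_iff by blast
    then show ?thesis
      using emeasure_bounded_finite[of hartogs_triangle] by (auto simp: ennreal_mult_less_top)
  qed
  finally have "integrable (weighted_measure hartogs_triangle hartogs_weight) (\<lambda>z. (cmod (?f z))\<^sup>2)"
    by (intro integrableI_nonneg) auto
  then show ?thesis
    using hol meas by (simp add: weighted_L2a_iff sq_integrable_def)
qed

theorem theorem1p2:
  fixes \<tau> \<gamma> r :: real
  assumes "\<tau> > 0" and "\<gamma> > 1" and "r > 0"
  shows "\<not> bounded ((\<lambda>z. complex_of_real (hartogs_delta z powr \<tau>)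
                          * bergman_kernel hartogs_triangle hartogs_weight z z)
                    ` {z \<in> hartogs_triangle \<inter> hartogs_cone \<gamma>. norm z < r})"
proof
  let ?K = "bergman_kernel hartogs_triangle hartogs_weight"
  assume "bounded ((\<lambda>z. complex_of_real (hartogs_delta z powr \<tau>) * ?K z z)
                    ` {z \<in> hartogs_triangle \<inter> hartogs_cone \<gamma>. norm z < r})"
  then obtain B where B: "\<And>z. z \<in> hartogs_triangle \<Longrightarrow> z \<in> hartogs_cone \<gamma> \<Longrightarrow> norm z < r \<Longrightarrow>
      cmod (complex_of_real (hartogs_delta z powr \<tau>) * ?K z z) \<le> B"
    unfolding bounded_iff by blast
  define N where "N = nat \<lceil>\<tau>\<rceil> + 1"
  \<comment> \<open>with this \<open>N\<close> the exponent \<open>\<tau> - 2 N\<close> is at most \<open>- 1\<close>, and the lower bound becomes \<open>1 / t\<close>\<close>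
  have "\<tau> \<le> real N - 1"
    unfolding N_def using real_nat_ceiling_ge[of \<tau>] by linarith
  then have N: "real (2 * N) \<ge> \<tau> + 1"
    using \<open>\<tau> > 0\<close> by simp
  define S where "S = l2_sq (weighted_measure hartogs_triangle hartogs_weight) (\<lambda>z. inverse (fst z) ^ N)"
  have S: "S \<ge> 0" by (simp add: S_def l2_sq_nonneg)
  have main: "1 / t \<le> B * S" if t: "0 < t" "t < 1" "t < r" for t
  proof -
    define z where "z = (complex_of_real t, 0 :: complex)"
    have z: "z \<in> hartogs_triangle" "z \<in> hartogs_cone \<gamma>" "norm z < r"
      using t by (auto simp: z_def hartogs_triangle_def hartogs_cone_def norm_Pair)
    have "1 / t = t powr (- 1)"
      using t by (simp add: powr_minus_divide)
    also have "\<dots> \<le> t powr (\<tau> - real (2 * N))"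
      using t N by (intro powr_mono') auto
    also have "\<dots> = t powr \<tau> * (1 / t ^ (2 * N))"
      using t by (simp only: powr_diff powr_realpow) simp
    also have "1 / t ^ (2 * N) = (cmod (inverse (fst z) ^ N))\<^sup>2"
      using t by (simp add: z_def norm_power norm_inverse norm_divide power_mult[symmetric] mult.commute power_inverse inverse_eq_divide power_one_over)
    also have "t powr \<tau> * \<dots> \<le> t powr \<tau> * (cmod (?K z z) * S)"
      unfolding S_def
      by (intro mult_left_mono hartogs.bergman_kernel_diagonal_bound[OF negative_power_in_hartogs_L2a z(1)]) auto
    also have "\<dots> = cmod (complex_of_real (hartogs_delta z powr \<tau>) * ?K z z) * S"
      using t by (simp add: z_def hartogs_delta_def norm_mult)
    also have "\<dots> \<le> B * S"
      using B[OF z] S by (rule mult_right_mono)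
    finally show ?thesis .
  qed
  define t where "t = min (min (1/2) (r / 2)) (1 / (\<bar>B * S\<bar> + 1))"
  have t: "0 < t" "t < 1" "t < r" "t \<le> 1 / (\<bar>B * S\<bar> + 1)"
    using \<open>r > 0\<close> by (auto simp: t_def)
  then have "\<bar>B * S\<bar> + 1 \<le> 1 / t"
    by (simp add: field_simps)
  with main[OF t(1-3)] show False by linarith
qed

end
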